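(* Let $\Omega\subset\mathbb{R}^d$, $d\ge 2$, be a domain, let $T>0$, and let $3\le r,q\le\infty$ be such that $$ s = d\,\frac{r-2}{r}-\frac{2}{q-1}\,\frac{r+d}{r}\ \ge 0,\qquad \alpha=\frac{q}{q-1}\,\frac{r+d}{r}>0, $$ with $s=d$ and $\alpha=1$ whenever $r=q=\infty$. Let $u\in L^q_{\rm loc}(0,T;L^r_{\rm loc}(\Omega))$ and $p\in L^{q/2}_{\rm loc}(0,T;L^{r/2}_{\rm loc}(\Omega))$ be a weak solution of the incompressible Euler equations having non-negative local anomalous dissipation measure $\varepsilon[u]\in\mathcal{M}_{\rm loc}(\Omega\times(0,T))$. Then $\varepsilon[u]\ll\mathcal{H}^s_\alpha$ and, if $\varepsilon[u]$ is non-trivial and concentrated on a space-time set $S$, then $$\dim_{\mathcal{H}_\alpha}S\ge s.$$ Further, when $\Omega$ is bounded and $(u,p)\in L^q(0,T;L^r(\Omega))\times L^{q/2}(0,T;L^{r/2}(\Omega))$ has a positive boundary extendable dissipation $\overline{\varepsilon}[u]\in\mathcal{M}_{\rm loc}(\overline\Omega\times(0,T])$, the same conclusions hold for $\overline{\varepsilon}[u]$: $\overline\varepsilon[u]\ll\mathcal{H}^s_\alpha$, and if $\overline\varepsilon[u]$ is non-trivial and concentrated on a space-time set $S$, then $\dim_{\mathcal{H}_\alpha}S\ge s$.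
   Context: Conventions for infinite exponents: if $r=\infty$ then $\frac{r-2}{r}=\frac{r+d}{r}=1$; if $q=\infty$ then $\frac{2}{q-1}=0$ and $\frac{q}{q-1}=1$. $\mathcal{M}_{\rm loc}(X)$ denotes locally finite Borel (Radon) measures on $X$. The domain $\Omega$ possibly has smooth boundary. Euler equations: $\partial_t u+(u\cdot\nabla)u=-\nabla p$, $\operatorname{div}u=0$ in $\Omega\times(0,T)$, $u\cdot n=0$ on $\partial\Omega\times(0,T)$ ($n$ the outward unit normal). A weak solution satisfies the first two equations in the sense of distributions, i.e. $\int_0^T\int_\Omega (u\cdot\partial_t\phi+u\otimes u:\nabla\phi+p\operatorname{div}\phi)\,dx\,dt=0$ for all $\phi\in C_c^\infty(\Omega\times(0,T);\mathbb{R}^d)$ and $\operatorname{div}u=0$ distributionally; the boundary condition is meant in the weak sense (when $u$ is integrable up to the boundary: $\int_0^T\int_\Omega u\cdot\nabla\varphi\,dx\,dt=0$ for all $\varphi\in C^1_c(\overline\Omega\times(0,T))$). Anomalous dissipation: $\varepsilon[u]:=-\partial_t\frac{|u|^2}{2}-\operatorname{div}\big(\big(\frac{|u|^2}{2}+p\big)u\big)$ in the sense of distributions on $\Omega\times(0,T)$; saying that it is a non-negative local measure means that for some positive $\varepsilon[u]\in\mathcal{M}_{\rm loc}(\Omega\times(0,T))$, $\int_0^T\int_\Omega\big[\frac{|u|^2}{2}\partial_t\varphi+\big(\frac{|u|^2}{2}+p\big)u\cdot\nabla\varphi\big]dx\,dt=\int\varphi\,d\varepsilon[u]$ for all $\varphi\in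 C^1_c(\Omega\times(0,T))$. Boundary extendable dissipation: for $\Omega$ bounded and a solution $u\in L^3(\Omega\times(0,T))$, $p\in L^{3/2}(\Omega\times(0,T))$ of the Euler system, $u$ has a positive boundary extendable dissipation if there is a positive measure $\overline\varepsilon[u]\in\mathcal{M}_{\rm loc}(\overline\Omega\times(0,T])$ such that $\int_0^T\int_\Omega\big[\frac{|u|^2}{2}\partial_t\varphi+\big(\frac{|u|^2}{2}+p\big)u\cdot\nabla\varphi\big]dx\,dt=\int_{\overline\Omega\times(0,T]}\varphi\,d\overline\varepsilon[u]$ for all $\varphi\in C^1_c(\overline\Omega\times(0,T])$. Anisotropic Hausdorff measure: for $\alpha\ge0$, $\delta>0$, let $\mathcal{C}^\alpha_\delta(x,t)=B_\delta(x)\times(t-\delta^\alpha,t+\delta^\alpha)\subset\mathbb{R}^d\times\mathbb{R}$. For $s\ge0$, $\mathcal{H}^s_\alpha$ is the measure obtained by Carathéodory's construction from the family of all such cylinders with gauge $\Psi^s(\mathcal{C}^\alpha_\delta(x,t))=\delta^s$, i.e. $\mathcal{H}^s_\alpha(A)=\lim_{\rho\to0^+}\inf\{\sum_i r_i^s\}$, the infimum over at most countable covers $\{\mathcal{C}^\alpha_{r_i}(x_i,t_i)\}_i$ of $A$ by cylinders of diameter $\le\rho$. For a Borel set $A$, $\dim_{\mathcal{H}_\alpha}(A)=\inf\{s\ge0:\mathcal{H}^s_\alpha(A)=0\}$. A measure $\mu$ is concentrated on a (Borel) set $S$ if $\mu(A)=\mu(A\cap S)$ for all measurable $A$. $\mu\ll\mathcal{H}^s_\alpha$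 means $\mathcal{H}^s_\alpha(A)=0\Rightarrow\mu(A)=0$ for Borel sets $A$ in the space where $\mu$ is defined. *)

theory Defs
  imports "HOL-Probability.Essential_Supremum"
begin

section \<open>Exponents\<close>

text \<open>Integrability exponents range over \<^typ>\<open>ennreal\<close>. The quotients in the exponents \<open>s\<close> and
  \<open>\<alpha>\<close> take their limiting values when \<open>r\<close> or \<open>q\<close> is infinite, which is not what
  extended division would return.\<close>

definition dissip_exponent :: "nat \<Rightarrow> ennreal \<Rightarrow> ennreal \<Rightarrow> real" where
  "dissip_exponent d r q =
     real d * (if r = top then 1 else (enn2real r - 2) / enn2real r)
     - (if q = top then 0 else 2 / (enn2real q - 1))
       * (if r = top then 1 else (enn2real r + real d) / enn2real r)"

definition time_exponent :: "nat \<Rightarrow> ennreal \<Rightarrow> ennreal \<Rightarrow> real" where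
  "time_exponent d r q =
     (if q = top then 1 else enn2real q / (enn2real q - 1))
     * (if r = top then 1 else (enn2real r + real d) / enn2real r)"


section \<open>Mixed Lebesgue spaces\<close>

text \<open>Only used with a positive exponent \<open>a\<close>.\<close>

definition ennreal_powr :: "ennreal \<Rightarrow> real \<Rightarrow> ennreal" where
  "ennreal_powr x a = (if x = top then top else ennreal (enn2real x powr a))"

definition lp_norm :: "ennreal \<Rightarrow> 'a measure \<Rightarrow> ('a \<Rightarrow> ennreal) \<Rightarrow> ennreal" where
  "lp_norm p M f =
     (if p = top then esssup M f
      else ennreal_powr (\<integral>\<^sup>+x. ennreal_powr (f x) (enn2real p) \<partial>M) (1 / enn2real p))"

definition lp_space ::
    "ennreal \<Rightarrow> 'a::euclidean_space set \<Rightarrow> ('a \<Rightarrow> 'b::euclidean_space) set" where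
  "lp_space p A = {f \<in> borel_measurable (lebesgue_on A).
     lp_norm p (lebesgue_on A) (\<lambda>x. ennreal (norm (f x))) < top}"

text \<open>Space-time points are pairs \<open>(x, t)\<close>; the inner norm is taken in space, the outer in time.\<close>

definition mixed_norm ::
    "ennreal \<Rightarrow> real set \<Rightarrow> ennreal \<Rightarrow> 'a::euclidean_space set
      \<Rightarrow> ('a \<times> real \<Rightarrow> 'b::euclidean_space) \<Rightarrow> ennreal" where
  "mixed_norm q J r A f =
     lp_norm q (lebesgue_on J)
       (\<lambda>t. lp_norm r (lebesgue_on A) (\<lambda>x. ennreal (norm (f (x, t)))))"

text \<open>\<open>L\<^sup>q(J; L\<^sup>r(A))\<close>, with elements represented by jointly Lebesgue measurable functions.\<close>

definition mixed_space ::
    "ennreal \<Rightarrow> real set \<Rightarrow> ennreal \<Rightarrow> 'a::euclidean_space set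
      \<Rightarrow> ('a \<times> real \<Rightarrow> 'b::euclidean_space) set" where
  "mixed_space q J r A =
     {f \<in> borel_measurable (lebesgue_on (A \<times> J)). mixed_norm q J r A f < top}"

definition mixed_space_loc ::
    "ennreal \<Rightarrow> real set \<Rightarrow> ennreal \<Rightarrow> 'a::euclidean_space set
      \<Rightarrow> ('a \<times> real \<Rightarrow> 'b::euclidean_space) set" where
  "mixed_space_loc q J r A =
     {f \<in> borel_measurable (lebesgue_on (A \<times> J)).
        \<forall>J' A'. compact J' \<and> J' \<subseteq> J \<and> compact A' \<and> A' \<subseteq> A \<longrightarrow> mixed_norm q J' r A' f < top}"

text \<open>Integrability on \<open>Q\<close> locally in \<open>X\<close>: for \<open>X = Q\<close> this is local integrability, for
  \<open>X\<close> containing boundary points of \<open>Q\<close> it is integrability up to that part of the boundary.\<close>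

definition locally_integrable_in ::
    "'a::euclidean_space set \<Rightarrow> 'a set \<Rightarrow> ('a \<Rightarrow> 'b::euclidean_space) \<Rightarrow> bool" where
  "locally_integrable_in X Q f \<longleftrightarrow>
     (\<forall>K. compact K \<and> K \<subseteq> X \<longrightarrow> integrable (lebesgue_on (K \<inter> Q)) f)"


section \<open>Test functions and differential operators\<close>

text \<open>Functions of class \<open>C\<^sup>k\<close> on the whole space. Continuity of all directional derivatives
  is continuity of the derivative since the domain is finite-dimensional.\<close>

primrec class_C :: "nat \<Rightarrow> ('a::euclidean_space \<Rightarrow> 'b::euclidean_space) \<Rightarrow> bool" where
  "class_C 0 f \<longleftrightarrow> continuous_on UNIV f"
| "class_C (Suc k) f \<longleftrightarrow>
     (\<forall>x. f differentiable (at x)) \<and> (\<forall>v. class_C k (\<lambda>x. frechet_derivative f (at x) v))"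

text \<open>\<open>C\<^sup>k\<^sub>c(X)\<close>: restrictions to \<open>X\<close> of \<open>C\<^sup>k\<close> functions on the whole space, vanishing on \<open>X\<close>
  outside a compact subset of \<open>X\<close>. Values outside \<open>X\<close> are never used. For open \<open>X\<close> these are
  the usual compactly supported functions, as the extension by zero is of class \<open>C\<^sup>k\<close>; for
  \<open>X = \<Omega>' \<times> (0,T]\<close>, with \<open>\<Omega>'\<close> the closure of \<open>\<Omega>\<close>, they need not vanish on the boundary of
  \<open>\<Omega>\<close> nor at time \<open>T\<close>.\<close>

definition test_C ::
    "nat \<Rightarrow> 'a::euclidean_space set \<Rightarrow> ('a \<Rightarrow> 'b::euclidean_space) set" where
  "test_C k X = {\<phi>. class_C k \<phi> \<and> (\<exists>K. compact K \<and> K \<subseteq> X \<and> (\<forall>z\<in>X - K. \<phi> z = 0))}"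

definition test_C_infinity ::
    "'a::euclidean_space set \<Rightarrow> ('a \<Rightarrow> 'b::euclidean_space) set" where
  "test_C_infinity X = (\<Inter>k. test_C k X)"

definition time_deriv ::
    "('a::euclidean_space \<times> real \<Rightarrow> 'b::euclidean_space) \<Rightarrow> 'a \<times> real \<Rightarrow> 'b" where
  "time_deriv \<phi> z = frechet_derivative \<phi> (at z) (0, 1)"

definition space_deriv ::
    "'a \<Rightarrow> ('a::euclidean_space \<times> real \<Rightarrow> 'b::euclidean_space) \<Rightarrow> 'a \<times> real \<Rightarrow> 'b" where
  "space_deriv v \<phi> z = frechet_derivative \<phi> (at z) (v, 0)"

definition space_grad :: "('a::euclidean_space \<times> real \<Rightarrow> real) \<Rightarrow> 'a \<times> real \<Rightarrow> 'a" where
  "space_grad \<phi> z = (\<Sum>i\<in>Basis. space_deriv i \<phi> z *\<^sub>R i)"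

definition space_div :: "('a::euclidean_space \<times> real \<Rightarrow> 'a) \<Rightarrow> 'a \<times> real \<Rightarrow> real" where
  "space_div \<phi> z = (\<Sum>i\<in>Basis. space_deriv i \<phi> z \<bullet> i)"

text \<open>\<open>(v \<otimes> v) : \<nabla>\<phi>\<close>, the sum of \<open>v\<^sub>i v\<^sub>j \<partial>\<^sub>j \<phi>\<^sub>i\<close>.\<close>

definition tensor_grad ::
    "'a \<Rightarrow> ('a::euclidean_space \<times> real \<Rightarrow> 'a) \<Rightarrow> 'a \<times> real \<Rightarrow> real" where
  "tensor_grad v \<phi> z =
     (\<Sum>i\<in>Basis. \<Sum>j\<in>Basis. (v \<bullet> i) * (v \<bullet> j) * (space_deriv j \<phi> z \<bullet> i))"


section \<open>Weak solutions of the Euler equations\<close>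

text \<open>The impermeability condition is imposed exactly when its weak form makes sense, that is,
  when \<open>u\<close> is integrable up to the boundary of \<open>\<Omega>\<close>.\<close>

definition weak_euler_solution ::
    "'a::euclidean_space set \<Rightarrow> real \<Rightarrow> ('a \<times> real \<Rightarrow> 'a) \<Rightarrow> ('a \<times> real \<Rightarrow> real) \<Rightarrow> bool" where
  "weak_euler_solution \<Omega> T u p \<longleftrightarrow>
     (let Q = \<Omega> \<times> {0<..<T}; X = closure \<Omega> \<times> {0<..<T} in
       locally_integrable_in Q Q u \<and>
       locally_integrable_in Q Q (\<lambda>z. (norm (u z))\<^sup>2) \<and>
       locally_integrable_in Q Q p \<and>
       (\<forall>\<phi>\<in>test_C_infinity Q.
          (\<integral>z. u z \<bullet> time_deriv \<phi> z + tensor_grad (u z) \<phi> z + p z * space_div \<phi> z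
             \<partial>lebesgue_on Q) = 0) \<and>
       (\<forall>\<psi>\<in>test_C_infinity Q. (\<integral>z. u z \<bullet> space_grad \<psi> z \<partial>lebesgue_on Q) = 0) \<and>
       (locally_integrable_in X Q u \<longrightarrow>
          (\<forall>\<psi>\<in>test_C 1 X. (\<integral>z. u z \<bullet> space_grad \<psi> z \<partial>lebesgue_on Q) = 0)))"


section \<open>Local measures and dissipation\<close>

text \<open>Positive elements of \<open>\<M>\<^sub>l\<^sub>o\<^sub>c(X)\<close>. In a locally compact \<open>X\<close>, such as those used below,
  local finiteness is finiteness on compact sets.\<close>

definition local_measure :: "'a::euclidean_space set \<Rightarrow> 'a measure \<Rightarrow> bool" where
  "local_measure X \<mu> \<longleftrightarrow>
     sets \<mu> = sets (restrict_space borel X) \<and>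
     (\<forall>K. compact K \<and> K \<subseteq> X \<longrightarrow> emeasure \<mu> K < top)"

definition energy_flux ::
    "('a::euclidean_space \<times> real \<Rightarrow> 'a) \<Rightarrow> ('a \<times> real \<Rightarrow> real) \<Rightarrow> 'a \<times> real \<Rightarrow> 'a" where
  "energy_flux u p z = ((norm (u z))\<^sup>2 / 2 + p z) *\<^sub>R u z"

definition energy_pairing ::
    "('a::euclidean_space \<times> real) set \<Rightarrow> ('a \<times> real \<Rightarrow> 'a) \<Rightarrow> ('a \<times> real \<Rightarrow> real)
      \<Rightarrow> ('a \<times> real \<Rightarrow> real) \<Rightarrow> real" where
  "energy_pairing Q u p \<phi> =
     (\<integral>z. (norm (u z))\<^sup>2 / 2 * time_deriv \<phi> z + energy_flux u p z \<bullet> space_grad \<phi> z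
        \<partial>lebesgue_on Q)"

definition local_dissipation ::
    "'a::euclidean_space set \<Rightarrow> real \<Rightarrow> ('a \<times> real \<Rightarrow> 'a) \<Rightarrow> ('a \<times> real \<Rightarrow> real)
      \<Rightarrow> ('a \<times> real) measure \<Rightarrow> bool" where
  "local_dissipation \<Omega> T u p \<epsilon> \<longleftrightarrow>
     (let Q = \<Omega> \<times> {0<..<T} in
       locally_integrable_in Q Q (energy_flux u p) \<and>
       local_measure Q \<epsilon> \<and>
       (\<forall>\<phi>\<in>test_C 1 Q. energy_pairing Q u p \<phi> = (\<integral>z. \<phi> z \<partial>\<epsilon>)))"

definition boundary_extendable_dissipation ::
    "'a::euclidean_space set \<Rightarrow> real \<Rightarrow> ('a \<times> real \<Rightarrow> 'a) \<Rightarrow> ('a \<times> real \<Rightarrow> real)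
      \<Rightarrow> ('a \<times> real) measure \<Rightarrow> bool" where
  "boundary_extendable_dissipation \<Omega> T u p \<epsilon> \<longleftrightarrow>
     (let Q = \<Omega> \<times> {0<..<T}; X = closure \<Omega> \<times> {0<..T} in
       bounded \<Omega> \<and> weak_euler_solution \<Omega> T u p \<and>
       u \<in> lp_space 3 Q \<and> p \<in> lp_space (3 / 2) Q \<and>
       local_measure X \<epsilon> \<and>
       (\<forall>\<phi>\<in>test_C 1 X. energy_pairing Q u p \<phi> = (\<integral>z. \<phi> z \<partial>\<epsilon>)))"


section \<open>Anisotropic Hausdorff measure and dimension\<close>

definition cylinder :: "real \<Rightarrow> real \<Rightarrow> 'a::euclidean_space \<times> real \<Rightarrow> ('a \<times> real) set" where
  "cylinder \<alpha> \<delta> z =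
     ball (fst z) \<delta> \<times> {snd z - \<delta> powr \<alpha> <..< snd z + \<delta> powr \<alpha>}"

text \<open>At most countable covers are families indexed by an arbitrary set \<open>I\<close> of natural numbers.
  The infimum over no admissible cover is infinite.\<close>

definition aniso_premeasure ::
    "real \<Rightarrow> real \<Rightarrow> real \<Rightarrow> ('a::euclidean_space \<times> real) set \<Rightarrow> ennreal" where
  "aniso_premeasure \<alpha> s \<rho> A =
     Inf {(\<Sum>\<^sub>\<infinity>i\<in>I. ennreal (\<delta> i powr s)) | (I :: nat set) \<delta> z.
            (\<forall>i\<in>I. 0 < \<delta> i \<and> diameter (cylinder \<alpha> (\<delta> i) (z i)) \<le> \<rho>) \<and>
            A \<subseteq> (\<Union>i\<in>I. cylinder \<alpha> (\<delta> i) (z i))}"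

definition aniso_hausdorff ::
    "real \<Rightarrow> real \<Rightarrow> ('a::euclidean_space \<times> real) set \<Rightarrow> ennreal" where
  "aniso_hausdorff \<alpha> s A = Lim (at_right 0) (\<lambda>\<rho>. aniso_premeasure \<alpha> s \<rho> A)"

text \<open>The limit always exists.\<close>

lemma aniso_premeasure_antimono:
  assumes "\<rho> \<le> \<rho>'"
  shows "aniso_premeasure \<alpha> s \<rho>' A \<le> aniso_premeasure \<alpha> s \<rho> A"
  unfolding aniso_premeasure_def
  by (rule Inf_superset_mono) (use assms in \<open>fastforce intro: order_trans\<close>)

lemma tendsto_aniso_premeasure:
  "((\<lambda>\<rho>. aniso_premeasure \<alpha> s \<rho> A) \<longlongrightarrow> (SUP \<rho>\<in>{0<..}. aniso_premeasure \<alpha> s \<rho> A)) (at_right 0)"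
proof (rule order_tendstoI)
  fix a assume "a < (SUP \<rho>\<in>{0<..}. aniso_premeasure \<alpha> s \<rho> A)"
  then obtain \<rho>0 where \<rho>0: "\<rho>0 > 0" "a < aniso_premeasure \<alpha> s \<rho>0 A"
    by (auto simp: less_SUP_iff)
  have "\<forall>\<^sub>F \<rho> in at_right 0. \<rho> < \<rho>0"
    using \<rho>0(1) by (auto simp: eventually_at_right_field)
  then show "\<forall>\<^sub>F \<rho> in at_right 0. a < aniso_premeasure \<alpha> s \<rho> A"
    by eventually_elim (use \<rho>0 aniso_premeasure_antimono less_le_trans in \<open>metis less_imp_le\<close>)
next
  fix a assume a: "(SUP \<rho>\<in>{0<..}. aniso_premeasure \<alpha> s \<rho> A) < a"
  have "\<forall>\<^sub>F \<rho> in at_right (0::real). 0 < \<rho>"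
    by (simp add: eventually_at_right_less)
  then show "\<forall>\<^sub>F \<rho> in at_right 0. aniso_premeasure \<alpha> s \<rho> A < a"
    by eventually_elim (rule le_less_trans[OF SUP_upper a], simp)
qed

lemma aniso_hausdorff_eq_SUP:
  "aniso_hausdorff \<alpha> s A = (SUP \<rho>\<in>{0<..}. aniso_premeasure \<alpha> s \<rho> A)"
  unfolding aniso_hausdorff_def
  by (rule tendsto_Lim[OF _ tendsto_aniso_premeasure]) simp

definition aniso_dim :: "real \<Rightarrow> ('a::euclidean_space \<times> real) set \<Rightarrow> ereal" where
  "aniso_dim \<alpha> A = Inf {ereal s | s. 0 \<le> s \<and> aniso_hausdorff \<alpha> s A = 0}"

definition concentrated_on :: "'a::topological_space measure \<Rightarrow> 'a set \<Rightarrow> bool" where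
  "concentrated_on \<mu> S \<longleftrightarrow>
     S \<in> sets borel \<and> (\<forall>A\<in>sets \<mu>. emeasure \<mu> A = emeasure \<mu> (A \<inter> S))"

definition abs_cont_aniso_hausdorff ::
    "('a::euclidean_space \<times> real) measure \<Rightarrow> real \<Rightarrow> real \<Rightarrow> bool" where
  "abs_cont_aniso_hausdorff \<mu> \<alpha> s \<longleftrightarrow>
     (\<forall>A\<in>sets \<mu>. aniso_hausdorff \<alpha> s A = 0 \<longrightarrow> emeasure \<mu> A = 0)"

end

theory Submission
  imports Defs
begin

text \<open>
  The theorem follows from one estimate: in every small anisotropic cylinder of radius \<open>\<delta>\<close> the
  dissipation measure has mass at most \<open>C \<delta>\<^sup>s\<close>. A measure with such an upper density bound cannot
  charge a set that has covers with arbitrarily small \<open>\<Sum> \<delta>\<^sub>i\<^sup>s\<close>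
  (\<open>abs_cont_if_locally_density_bound\<close>), hence
  \<open>\<epsilon> \<lless> \<H>\<^sup>s\<^sub>\<alpha>\<close>. If \<open>\<epsilon>\<close> is concentrated on \<open>S\<close> and \<open>dim S < s\<close>, then \<open>S\<close> is null
  for some \<open>\<H>\<^sup>s\<^sup>'\<^sub>\<alpha>\<close> with \<open>s' < s\<close>, therefore for \<open>\<H>\<^sup>s\<^sub>\<alpha>\<close>, and \<open>\<epsilon>\<close> vanishes.

  For the density bound, the local energy identity is tested with a nonnegative \<open>C\<^sup>1\<close> function
  \<open>\<phi>\<close> that is at least \<open>1\<close> on the cylinder of radius \<open>\<delta>\<close>, lives on a cylinder of twice the size,
  and satisfies \<open>|\<partial>\<^sub>t\<phi>| \<le> c \<delta>\<^sup>-\<^sup>\<alpha>\<close> and \<open>|\<nabla>\<phi>| \<le> c \<delta>\<^sup>-\<^sup>1\<close>. This bounds the mass by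
  \<open>\<delta>\<^sup>-\<^sup>\<alpha> \<integral>|u|\<^sup>2 + \<delta>\<^sup>-\<^sup>1 \<integral>(|u|\<^sup>3 + |p|\<^bsup>3/2\<^esup>)\<close> over the larger cylinder.
  Hoelder's inequality, first in space and then in time, turns the integral of an \<open>a\<close>-th power into
  a power of the mixed norm times \<open>(\<delta>\<^sup>d)\<^bsup>1-a/r\<^esup> (\<delta>\<^sup>\<alpha>)\<^bsup>1-a/q\<^esup>\<close>. The values of \<open>\<alpha>\<close> and \<open>s\<close> are
  exactly those for which the quadratic term and the cubic terms both scale like \<open>\<delta>\<^sup>s\<close>
  (\<open>scaling_exponents\<close>); the bound itself is \<open>dissipation_cylinder_bound\<close>.

  Interior and boundary dissipation differ merely in the choice of the region on which the norms are
  finite and of the compact set that carries the test function: in the interior the region is a small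
  compact cylinder, up to the boundary it is the whole of \<open>\<Omega> \<times> (0,T)\<close>.
\<close>

section \<open>Powers of extended nonnegative numbers\<close>

lemma ennreal_powr_mono: "x \<le> y \<Longrightarrow> 0 \<le> a \<Longrightarrow> ennreal_powr x a \<le> ennreal_powr y a"
  by (cases x; cases y) (auto simp: ennreal_powr_def powr_mono2 top_unique)

lemma ennreal_powr_ennreal: "0 \<le> x \<Longrightarrow> ennreal_powr (ennreal x) a = ennreal (x powr a)"
  by (simp add: ennreal_powr_def)

lemma ennreal_powr_powr: "ennreal_powr (ennreal_powr x a) b = ennreal_powr x (a * b)"
  by (cases x) (auto simp: ennreal_powr_def powr_powr)

lemma ennreal_powr_one: "ennreal_powr x 1 = x"
  by (cases x) (auto simp: ennreal_powr_def)

lemma ennreal_powr_top: "ennreal_powr top a = top"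
  by (simp add: ennreal_powr_def)

lemma ennreal_powr_eq_0_iff: "ennreal_powr x a = 0 \<longleftrightarrow> x = 0"
  by (cases x) (auto simp: ennreal_powr_def)

lemma ennreal_powr_less_top: "x < top \<Longrightarrow> ennreal_powr x a < top"
  by (simp add: ennreal_powr_def)

lemma borel_measurable_ennreal_powr [measurable]:
  assumes [measurable]: "f \<in> borel_measurable M"
  shows "(\<lambda>x. ennreal_powr (f x) a) \<in> borel_measurable M"
  unfolding ennreal_powr_def by measurable

text \<open>Splitting at the level \<open>l\<close>: below it \<open>y\<^sup>a \<le> l\<^sup>a\<close>, above it
  \<open>y\<^sup>a = y\<^bsup>a-b\<^esup> y\<^sup>b\<close> with a factor \<open>y\<^bsup>a-b\<^esup> \<le> l\<^bsup>a-b\<^esup>\<close>. With \<open>l\<close> optimised after integration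
  this yields Hoelder's inequality up to a factor \<open>2\<close>.\<close>

lemma ennreal_powr_split:
  assumes "0 < l" "0 < a" "a \<le> b"
  shows "ennreal_powr y a \<le> ennreal (l powr a) + ennreal (l powr (a - b)) * ennreal_powr y b"
proof (cases y)
  case (real w)
  show ?thesis
  proof (cases "w \<le> l")
    case True
    then show ?thesis
      using real assms by (auto simp: ennreal_powr_def intro!: add_increasing2 ennreal_leI powr_mono2)
  next
    case False
    then have "w powr a = w powr (a - b) * w powr b" using real assms
      by (simp flip: powr_add)
    also have "\<dots> \<le> l powr (a - b) * w powr b"
      using False assms by (intro mult_right_mono powr_mono2') auto
    finally show ?thesis using real assms
      by (auto simp: ennreal_powr_def simp flip: ennreal_mult' intro!: add_increasing ennreal_leI)
  qed
next
  case top
  then show ?thesis using assms by (simp add: ennreal_powr_def ennreal_mult_top)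
qed

section \<open>Hoelder inequalities in Lebesgue and mixed Lebesgue spaces\<close>

text \<open>The integral of a nonmeasurable \<open>g\<close> is a lower integral and its essential supremum is infinite,
  so monotonicity persists for arbitrary \<open>g\<close>. This spares a proof that the spatial norm of \<open>f(\<cdot>, t)\<close> depends measurably on \<open>t\<close>.\<close>

lemma lp_norm_mono_AE:
  assumes "f \<in> borel_measurable M" "AE x in M. f x \<le> g x"
  shows "lp_norm p M f \<le> lp_norm p M g"
proof (cases "p = top")
  case True
  then show ?thesis using assms by (simp add: lp_norm_def esssup_AE_mono)
next
  case False
  have "(\<integral>\<^sup>+x. ennreal_powr (f x) (enn2real p) \<partial>M) \<le> (\<integral>\<^sup>+x. ennreal_powr (g x) (enn2real p) \<partial>M)"
    using assms(2) by (intro nn_integral_mono_AE) (auto simp: ennreal_powr_mono)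
  then show ?thesis using False
    by (simp add: lp_norm_def ennreal_powr_mono)
qed

text \<open>The exponent \<open>1 - a/p\<close> of the measure of the domain when an \<open>a\<close>-th power is integrated
  against a bound in \<open>L\<^sup>p\<close>.\<close>

definition holder_gain :: "real \<Rightarrow> ennreal \<Rightarrow> real" where
  "holder_gain a p = (if p = top then 1 else 1 - a / enn2real p)"

lemma set_nn_integral_powr_le_lp_norm:
  assumes [measurable]: "f \<in> borel_measurable M" "B \<in> sets M"
    and B: "emeasure M B \<le> ennreal m" and m: "0 < m" and a: "0 < a" "ennreal a \<le> p"
  shows "(\<integral>\<^sup>+x\<in>B. ennreal_powr (f x) a \<partial>M)
           \<le> ennreal (2 * m powr holder_gain a p) * ennreal_powr (lp_norm p M f) a"
proof (cases "p = top")
  case True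
  have "(\<integral>\<^sup>+x\<in>B. ennreal_powr (f x) a \<partial>M)
          \<le> (\<integral>\<^sup>+x. ennreal_powr (esssup M f) a * indicator B x \<partial>M)"
    using esssup_AE[of f M] a
    by (intro nn_integral_mono_AE) (auto simp: ennreal_powr_mono split: split_indicator)
  also have "\<dots> = ennreal_powr (esssup M f) a * emeasure M B"
    by (rule nn_integral_cmult_indicator) simp
  also have "\<dots> \<le> ennreal_powr (esssup M f) a * ennreal (2 * m)"
    using m by (intro mult_left_mono order_trans[OF B] ennreal_leI) auto
  finally show ?thesis using True m by (simp add: lp_norm_def holder_gain_def mult.commute)
next
  case False
  define P where "P = enn2real p"
  have P: "a \<le> P" "0 < P"
    using False a unfolding P_def by (cases p; auto)+
  define S where "S = (\<integral>\<^sup>+x. ennreal_powr (f x) P \<partial>M)"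
  have N: "lp_norm p M f = ennreal_powr S (1 / P)"
    using False by (simp add: lp_norm_def S_def P_def)
  have g: "holder_gain a p = 1 - a / P" using False by (simp add: holder_gain_def P_def)
  consider "S = 0" | "S = top" | \<sigma> where "S = ennreal \<sigma>" "0 < \<sigma>"
    by (cases S) (auto simp: less_le)
  then show ?thesis
  proof cases
    case 1
    then have "AE x in M. ennreal_powr (f x) P = 0"
      unfolding S_def by (subst (asm) nn_integral_0_iff_AE) auto
    then have "(\<integral>\<^sup>+x\<in>B. ennreal_powr (f x) a \<partial>M) = 0"
      by (subst nn_integral_0_iff_AE) (auto simp: ennreal_powr_eq_0_iff)
    then show ?thesis by simp
  next
    case 2
    then show ?thesis using m by (simp add: N ennreal_powr_top ennreal_mult_top)
  next
    case 3
    \<comment> \<open>The splitting level that makes both terms equal to \<open>\<sigma>\<^bsup>a/P\<^esup> m\<^bsup>1-a/P\<^esup>\<close>.\<close>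
    define l where "l = (\<sigma> / m) powr (1 / P)"
    have l: "0 < l" using 3 m by (simp add: l_def)
    have "(\<integral>\<^sup>+x\<in>B. ennreal_powr (f x) a \<partial>M)
        \<le> (\<integral>\<^sup>+x. ennreal (l powr a) * indicator B x
              + ennreal (l powr (a - P)) * ennreal_powr (f x) P \<partial>M)"
      using ennreal_powr_split[OF l a(1) P(1)]
      by (intro nn_integral_mono) (auto split: split_indicator)
    also have "\<dots> = ennreal (l powr a) * emeasure M B + ennreal (l powr (a - P)) * S"
      by (subst nn_integral_add) (auto simp: nn_integral_cmult S_def nn_integral_cmult_indicator)
    also have "\<dots> \<le> ennreal (l powr a) * ennreal m + ennreal (l powr (a - P)) * S"
      using B by (intro add_mono mult_left_mono) auto
    also have "\<dots> = ennreal (l powr a * m + l powr (a - P) * \<sigma>)"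
      using 3 m by (simp add: ennreal_mult')
    also have "l powr a * m = m powr (1 - a / P) * \<sigma> powr (a / P)"
      using 3 m by (simp add: l_def powr_powr powr_divide powr_diff)
    also have "l powr (a - P) * \<sigma> = m powr (1 - a / P) * \<sigma> powr (a / P)"
    proof -
      have "l powr (a - P) = (\<sigma> / m) powr (a / P - 1)"
        using P by (simp add: l_def powr_powr diff_divide_distrib)
      also have "\<dots> = (\<sigma> powr (a / P) / m powr (a / P)) / (\<sigma> / m)"
        using 3 m by (simp add: powr_diff powr_divide)
      finally show ?thesis using 3 m by (simp add: powr_diff)
    qed
    also have "ennreal (m powr (1 - a / P) * \<sigma> powr (a / P) + m powr (1 - a / P) * \<sigma> powr (a / P))
       = ennreal (2 * m powr holder_gain a p) * ennreal (\<sigma> powr (a / P))"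
      by (simp add: g flip: ennreal_mult')
    also have "ennreal (\<sigma> powr (a / P)) = ennreal_powr (lp_norm p M f) a"
      using 3 by (simp add: N ennreal_powr_powr ennreal_powr_ennreal powr_powr)
    finally show ?thesis by simp
  qed
qed

lemma ae_lebesgue_cong:
  fixes f g :: "'a::euclidean_space \<Rightarrow> ennreal"
  assumes g: "g \<in> borel_measurable lebesgue" and eq: "AE x in lebesgue. f x = g x"
  shows "f \<in> borel_measurable lebesgue"
proof (rule measurableI)
  fix S :: "ennreal set" assume S: "S \<in> sets borel"
  have "AE x in lebesgue. x \<in> g -` S \<inter> space lebesgue \<longleftrightarrow> x \<in> f -` S \<inter> space lebesgue"
    using eq by eventually_elim simp
  from completion.in_sets_AE[OF this measurable_sets[OF g S]]
  show "f -` S \<inter> space lebesgue \<in> sets lebesgue" by simp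
qed simp

text \<open>Tonelli's theorem for Lebesgue measurable rather than Borel functions. A Borel representative
  agrees with \<open>F\<close> almost everywhere, hence on almost every section; completeness of Lebesgue measure
  transfers measurability back to \<open>F\<close>.\<close>

lemma lebesgue_sections:
  fixes F :: "'a::euclidean_space \<times> 'b::euclidean_space \<Rightarrow> ennreal"
  assumes "F \<in> borel_measurable lebesgue"
  shows "AE t in lebesgue. (\<lambda>x. F (x, t)) \<in> borel_measurable lebesgue"
    and "(\<lambda>t. \<integral>\<^sup>+x. F (x, t) \<partial>lebesgue) \<in> borel_measurable lebesgue"
    and "(\<integral>\<^sup>+z. F z \<partial>lebesgue) = (\<integral>\<^sup>+t. \<integral>\<^sup>+x. F (x, t) \<partial>lebesgue \<partial>lebesgue)"
proof -
  obtain G where G [measurable]: "G \<in> borel_measurable lborel" and FG: "AE z in lborel. F z = G z"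
    using completion_ex_borel_measurable[OF assms] by auto
  have G' [measurable]: "G \<in> borel_measurable (lborel \<Otimes>\<^sub>M lborel)"
    using G by (simp add: lborel_prod)
  have "AE z in lborel \<Otimes>\<^sub>M lborel. F z = G z" using FG unfolding lborel_prod .
  then have "AE z in lborel \<Otimes>\<^sub>M lborel. F (snd z, fst z) = G (snd z, fst z)"
    by (subst (asm) lborel_pair.distr_pair_swap)
       (auto dest!: AE_distrD[rotated] simp: split_beta)
  from lborel_pair.AE_pair[OF this]
  have sec: "AE t in lborel. AE x in lborel. F (x, t) = G (x, t)" by simp
  then have sec': "AE t in lebesgue. AE x in lebesgue. F (x, t) = G (x, t)"
    by (simp add: AE_completion_iff)
  have meas: "(\<lambda>x. G (x, t)) \<in> borel_measurable lborel" for t by measurable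
  show "AE t in lebesgue. (\<lambda>x. F (x, t)) \<in> borel_measurable lebesgue"
    using sec
  proof (intro AE_completion, elim AE_mp, intro AE_I2 impI)
    fix t assume t: "AE x in lborel. F (x, t) = G (x, t)"
    have "(\<lambda>x. G (x, t)) \<in> borel_measurable (lebesgue :: 'a measure)"
      using meas by (rule measurable_completion)
    then show "(\<lambda>x. F (x, t)) \<in> borel_measurable lebesgue"
      by (rule ae_lebesgue_cong) (use t in \<open>auto simp: AE_completion_iff\<close>)
  qed
  have eq: "AE t in lebesgue. (\<integral>\<^sup>+x. F (x, t) \<partial>lebesgue) = (\<integral>\<^sup>+x. G (x, t) \<partial>lborel)"
    using sec' by eventually_elim (auto simp: nn_integral_completion AE_completion_iff intro: nn_integral_cong_AE)
  have "(\<lambda>t. \<integral>\<^sup>+x. G (x, t) \<partial>lborel) \<in> borel_measurable lborel" by measurable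
  show "(\<lambda>t. \<integral>\<^sup>+x. F (x, t) \<partial>lebesgue) \<in> borel_measurable lebesgue"
    by (rule ae_lebesgue_cong[OF measurable_completion])
       (use eq in \<open>auto intro: measurable_completion\<close>)
  show "(\<integral>\<^sup>+z. F z \<partial>lebesgue) = (\<integral>\<^sup>+t. \<integral>\<^sup>+x. F (x, t) \<partial>lebesgue \<partial>lebesgue)"
  proof -
    have "(\<integral>\<^sup>+z. F z \<partial>lebesgue) = (\<integral>\<^sup>+z. G z \<partial>lborel)"
      using FG by (simp add: nn_integral_completion cong: nn_integral_cong_AE)
    also have "\<dots> = (\<integral>\<^sup>+t. \<integral>\<^sup>+x. G (x, t) \<partial>lborel \<partial>lborel)"
      by (simp add: lborel_pair.nn_integral_snd lborel_prod)
    also have "\<dots> = (\<integral>\<^sup>+t. \<integral>\<^sup>+x. F (x, t) \<partial>lebesgue \<partial>lebesgue)"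
      using eq by (subst nn_integral_completion[symmetric], intro nn_integral_cong_AE) auto
    finally show ?thesis .
  qed
qed

text \<open>Hoelder in space on almost every time slice bounds the slice integral \<open>h t\<close> by \<open>c (g t)\<^sup>a\<close>,
  where \<open>g t\<close> is the spatial norm; Hoelder in time finishes. The second application is made to the
  measurable function \<open>k = (h/c)\<^bsup>1/a\<^esup> \<le> g\<close>, since \<open>g\<close> is not known to be measurable.\<close>

lemma mixed_holder:
  fixes f :: "'a::euclidean_space \<times> real \<Rightarrow> 'b::euclidean_space"
  assumes f: "f \<in> borel_measurable (lebesgue_on (\<Omega> \<times> I))"
    and sets: "\<Omega> \<times> I \<in> sets lebesgue" "A \<in> sets lebesgue" "J \<in> sets lebesgue"
    and sub: "A \<subseteq> \<Omega>" "J \<subseteq> I"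
    and B: "B \<in> sets lebesgue" "B \<subseteq> A" "emeasure lebesgue B \<le> ennreal m" "0 < m"
    and L: "L \<in> sets lebesgue" "L \<subseteq> J" "emeasure lebesgue L \<le> ennreal l" "0 < l"
    and BL: "B \<times> L \<in> sets lebesgue"
    and a: "0 < a" "ennreal a \<le> \<rho>" "ennreal a \<le> \<kappa>"
  shows "(\<integral>\<^sup>+z\<in>B \<times> L. ennreal (norm (f z) powr a) \<partial>lebesgue)
      \<le> ennreal (4 * (m powr holder_gain a \<rho> * l powr holder_gain a \<kappa>))
          * ennreal_powr (mixed_norm \<kappa> J \<rho> A f) a"
proof -
  define F where "F z = ennreal (norm (if z \<in> \<Omega> \<times> I then f z else 0))" for z
  have F [measurable]: "F \<in> borel_measurable lebesgue"
    unfolding F_def using borel_measurable_if_I[OF f sets(1)] by measurable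
  define G where "G z = ennreal_powr (F z) a * indicator (B \<times> L) z" for z
  have G [measurable]: "G \<in> borel_measurable lebesgue"
    unfolding G_def using BL by measurable
  define h where "h t = (\<integral>\<^sup>+x. G (x, t) \<partial>lebesgue)" for t
  have h [measurable]: "h \<in> borel_measurable lebesgue"
    unfolding h_def by (rule lebesgue_sections(2)[OF G])
  have Gh: "(\<integral>\<^sup>+z. G z \<partial>lebesgue) = (\<integral>\<^sup>+t. h t \<partial>lebesgue)"
    unfolding h_def by (rule lebesgue_sections(3)[OF G])
  define g where "g t = lp_norm \<rho> (lebesgue_on A) (\<lambda>x. ennreal (norm (f (x, t))))" for t
  define c where "c = 2 * m powr holder_gain a \<rho>"
  have c: "0 < c" using B by (simp add: c_def)
  have hg: "h t \<le> ennreal c * ennreal_powr (g t) a"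
    if sec: "(\<lambda>x. F (x, t)) \<in> borel_measurable lebesgue" and t: "t \<in> J" for t
  proof -
    have secA: "(\<lambda>x. F (x, t)) \<in> borel_measurable (lebesgue_on A)"
      using sec by (rule measurable_restrict_space1)
    have eqF: "F (x, t) = ennreal (norm (f (x, t)))" if "x \<in> A" for x
      using that t sub by (auto simp: F_def)
    have BA: "B \<in> sets (lebesgue_on A)"
      using B sets by (simp add: sets_restrict_space_iff)
    have "h t \<le> (\<integral>\<^sup>+x. ennreal_powr (F (x, t)) a * indicator B x \<partial>lebesgue)"
      unfolding h_def G_def by (intro nn_integral_mono) (auto split: split_indicator)
    also have "\<dots> = (\<integral>\<^sup>+x. ennreal_powr (F (x, t)) a * indicator B x * indicator A x \<partial>lebesgue)"
      using B by (intro nn_integral_cong) (auto split: split_indicator)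
    also have "\<dots> = (\<integral>\<^sup>+x\<in>B. ennreal_powr (F (x, t)) a \<partial>lebesgue_on A)"
      using sets by (subst nn_integral_restrict_space) auto
    also have "\<dots> \<le> ennreal c * ennreal_powr (lp_norm \<rho> (lebesgue_on A) (\<lambda>x. F (x, t))) a"
      unfolding c_def using B sets a
      by (intro set_nn_integral_powr_le_lp_norm secA BA) (auto simp: emeasure_restrict_space)
    also have "lp_norm \<rho> (lebesgue_on A) (\<lambda>x. F (x, t)) \<le> g t"
      unfolding g_def by (rule lp_norm_mono_AE[OF secA])
        (use eqF sets in \<open>auto simp: AE_restrict_space_iff\<close>)
    finally show ?thesis
      using a by (simp add: ennreal_powr_mono mult_left_mono)
  qed
  define k where "k t = ennreal_powr (h t / ennreal c) (1 / a)" for t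
  have kh: "h t = ennreal c * ennreal_powr (k t) a" for t
  proof -
    have "ennreal c * (h t / ennreal c) = h t * ennreal c / ennreal c"
      by (simp add: ennreal_times_divide mult.commute)
    then show ?thesis
      using a c by (simp add: k_def ennreal_powr_powr ennreal_powr_one mult_divide_eq_ennreal)
  qed
  have "k t \<le> g t" if "h t \<le> ennreal c * ennreal_powr (g t) a" for t
  proof -
    have "h t / ennreal c \<le> ennreal_powr (g t) a"
      using that c by (simp add: divide_le_posI_ennreal)
    then have "k t \<le> ennreal_powr (ennreal_powr (g t) a) (1 / a)"
      unfolding k_def using a by (intro ennreal_powr_mono) auto
    then show ?thesis using a by (simp add: ennreal_powr_powr ennreal_powr_one)
  qed
  with hg have "AE t in lebesgue. t \<in> J \<longrightarrow> k t \<le> g t"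
    using lebesgue_sections(1)[OF F] by (auto elim!: eventually_mono)
  then have kg: "AE t in lebesgue_on J. k t \<le> g t"
    using sets by (simp add: AE_restrict_space_iff)
  have k: "k \<in> borel_measurable (lebesgue_on J)"
    unfolding k_def by (intro measurable_restrict_space1) measurable
  have LJ: "L \<in> sets (lebesgue_on J)"
    using L sets by (simp add: sets_restrict_space_iff)
  have "(\<integral>\<^sup>+z\<in>B \<times> L. ennreal (norm (f z) powr a) \<partial>lebesgue) = (\<integral>\<^sup>+z. G z \<partial>lebesgue)"
    using B L sub
    by (intro nn_integral_cong) (auto simp: G_def F_def ennreal_powr_ennreal split: split_indicator)
  also have "\<dots> = (\<integral>\<^sup>+t. h t * indicator L t \<partial>lebesgue)"
    unfolding Gh by (intro nn_integral_cong) (auto simp: h_def G_def split: split_indicator)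
  also have "\<dots> = (\<integral>\<^sup>+t. h t * indicator L t * indicator J t \<partial>lebesgue)"
    using L by (intro nn_integral_cong) (auto split: split_indicator)
  also have "\<dots> = (\<integral>\<^sup>+t. ennreal c * (ennreal_powr (k t) a * indicator L t) \<partial>lebesgue_on J)"
    using sets by (subst nn_integral_restrict_space) (auto simp: kh mult.assoc)
  also have "\<dots> = ennreal c * (\<integral>\<^sup>+t\<in>L. ennreal_powr (k t) a \<partial>lebesgue_on J)"
    by (intro nn_integral_cmult borel_measurable_times_ennreal borel_measurable_ennreal_powr
        borel_measurable_indicator k LJ)
  also have "\<dots> \<le> ennreal c * (ennreal (2 * l powr holder_gain a \<kappa>)
        * ennreal_powr (lp_norm \<kappa> (lebesgue_on J) k) a)"
    using L sets a
    by (intro mult_left_mono set_nn_integral_powr_le_lp_norm k LJ) (auto simp: emeasure_restrict_space)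
  also have "\<dots> \<le> ennreal c * (ennreal (2 * l powr holder_gain a \<kappa>)
        * ennreal_powr (mixed_norm \<kappa> J \<rho> A f) a)"
    unfolding mixed_norm_def g_def[symmetric] using a
    by (intro mult_left_mono ennreal_powr_mono lp_norm_mono_AE k kg) auto
  also have "\<dots> = ennreal (4 * (m powr holder_gain a \<rho> * l powr holder_gain a \<kappa>))
          * ennreal_powr (mixed_norm \<kappa> J \<rho> A f) a"
  proof -
    have "4 * (m powr holder_gain a \<rho> * l powr holder_gain a \<kappa>) = c * (2 * l powr holder_gain a \<kappa>)"
      by (simp add: c_def)
    then show ?thesis
      using c by (simp only: ennreal_mult'[OF less_imp_le] mult.assoc)
  qed
  finally show ?thesis .
qed

section \<open>Test functions adapted to a cylinder\<close>

text \<open>A \<open>C\<^sup>1\<close> profile given by a formula: at least \<open>1\<close> on \<open>[0,1]\<close> and zero from \<open>2\<close> on. Instead of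
  being constant on \<open>[0,1]\<close> it is bounded below there, which suffices to dominate an indicator
  function.\<close>

definition cutoff :: "real \<Rightarrow> real" where
  "cutoff y = (max 0 (2 - y))\<^sup>2"

lemma cutoff_deriv: "(cutoff has_real_derivative - 2 * max 0 (2 - y)) (at y)"
proof -
  consider "y < 2" | "y > 2" | "y = 2" by linarith
  then show ?thesis
  proof cases
    case 1
    have "((\<lambda>y. (2 - y)\<^sup>2) has_real_derivative - 2 * max 0 (2 - y)) (at y)"
      using 1 by (auto intro!: derivative_eq_intros)
    then show ?thesis
      by (rule has_field_derivative_transform_within_open[where S = "{..<2}"])
         (use 1 in \<open>auto simp: cutoff_def\<close>)
  next
    case 2
    have "((\<lambda>y. 0) has_real_derivative - 2 * max 0 (2 - y)) (at y)"
      using 2 by (auto intro!: derivative_eq_intros)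
    then show ?thesis
      by (rule has_field_derivative_transform_within_open[where S = "{2<..}"])
         (use 2 in \<open>auto simp: cutoff_def\<close>)
  next
    case 3
    \<comment> \<open>Caratheodory's criterion for the derivative at the point where the two branches meet.\<close>
    have "cutoff z - cutoff 2 = min 0 (z - 2) * (z - 2)" for z
      by (auto simp: cutoff_def max_def min_def power2_eq_square algebra_simps)
    moreover have "isCont (\<lambda>z. min 0 (z - 2)) (2::real)"
      by (intro continuous_intros)
    ultimately show ?thesis
      unfolding 3 CARAT_DERIV by (intro exI[of _ "\<lambda>z. min 0 (z - 2)"]) auto
  qed
qed

lemma cutoff_nonneg: "0 \<le> cutoff y" and cutoff_ge_1: "y \<le> 1 \<Longrightarrow> 1 \<le> cutoff y"
  and cutoff_le: "0 \<le> y \<Longrightarrow> cutoff y \<le> 4" and cutoff_eq_0: "2 \<le> y \<Longrightarrow> cutoff y = 0"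
proof -
  show "0 \<le> cutoff y" by (simp add: cutoff_def)
  show "1 \<le> cutoff y" if "y \<le> 1"
    using that power_mono[of 1 "2 - y" 2] by (simp add: cutoff_def)
  show "cutoff y \<le> 4" if "0 \<le> y"
    using that power_mono[of "max 0 (2 - y)" 2 2] by (simp add: cutoff_def)
  show "cutoff y = 0" if "2 \<le> y" using that by (simp add: cutoff_def)
qed

text \<open>The profile is composed with squared distances, which are smooth also at the centre of the
  cylinder.\<close>

definition bump :: "real \<Rightarrow> real \<Rightarrow> 'a::euclidean_space \<times> real \<Rightarrow> 'a \<times> real \<Rightarrow> real" where
  "bump \<delta> \<tau> c z =
     cutoff ((norm (fst z - fst c) / \<delta>)\<^sup>2) * cutoff (((snd z - snd c) / \<tau>)\<^sup>2)"

definition bump_deriv ::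
    "real \<Rightarrow> real \<Rightarrow> 'a::euclidean_space \<times> real \<Rightarrow> 'a \<times> real \<Rightarrow> 'a \<times> real \<Rightarrow> real" where
  "bump_deriv \<delta> \<tau> c z v =
     - 4 * max 0 (2 - (norm (fst z - fst c) / \<delta>)\<^sup>2) * ((fst z - fst c) \<bullet> fst v / \<delta>\<^sup>2)
         * cutoff (((snd z - snd c) / \<tau>)\<^sup>2)
     + cutoff ((norm (fst z - fst c) / \<delta>)\<^sup>2)
         * (- 4 * max 0 (2 - ((snd z - snd c) / \<tau>)\<^sup>2) * ((snd z - snd c) * snd v / \<tau>\<^sup>2))"

lemma bump_has_derivative: "(bump \<delta> \<tau> c has_derivative bump_deriv \<delta> \<tau> c z) (at z)"
proof -
  have X: "((\<lambda>z. (norm (fst z - fst c) / \<delta>)\<^sup>2) has_derivative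
      (\<lambda>v. 2 * ((fst z - fst c) \<bullet> fst v) / \<delta>\<^sup>2)) (at z)"
    unfolding power_divide power2_norm_eq_inner
    by (auto intro!: derivative_eq_intros simp: inner_commute algebra_simps divide_inverse)
  have Y: "((\<lambda>z. ((snd z - snd c) / \<tau>)\<^sup>2) has_derivative
      (\<lambda>v. 2 * ((snd z - snd c) * snd v) / \<tau>\<^sup>2)) (at z)"
    unfolding power_divide
    by (auto intro!: derivative_eq_intros simp: algebra_simps divide_inverse power2_eq_square)
  have "(bump \<delta> \<tau> c has_derivative
     (\<lambda>v. cutoff ((norm (fst z - fst c) / \<delta>)\<^sup>2)
            * ((- 2 * max 0 (2 - ((snd z - snd c) / \<tau>)\<^sup>2)) * (2 * ((snd z - snd c) * snd v) / \<tau>\<^sup>2))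
        + ((- 2 * max 0 (2 - (norm (fst z - fst c) / \<delta>)\<^sup>2)) * (2 * ((fst z - fst c) \<bullet> fst v) / \<delta>\<^sup>2))
            * cutoff (((snd z - snd c) / \<tau>)\<^sup>2))) (at z)"
    unfolding bump_def
    by (intro has_derivative_mult has_derivative_compose[OF X] has_derivative_compose[OF Y]
        cutoff_deriv[unfolded has_field_derivative_def])
  then show ?thesis
    by (rule has_derivative_eq_rhs) (auto simp: bump_deriv_def fun_eq_iff)
qed

lemma cutoff_continuous [continuous_intros]:
  "continuous_on A f \<Longrightarrow> continuous_on A (\<lambda>x. cutoff (f x))"
  unfolding cutoff_def by (intro continuous_intros)

lemma bump_frechet: "frechet_derivative (bump \<delta> \<tau> c) (at z) = bump_deriv \<delta> \<tau> c z"
  using bump_has_derivative by (rule frechet_derivative_at[symmetric])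

lemma bump_class_C: "class_C 1 (bump \<delta> \<tau> c)"
proof -
  have "continuous_on UNIV (\<lambda>z. bump_deriv \<delta> \<tau> c z v)" for v
    unfolding bump_deriv_def divide_inverse by (intro continuous_intros)
  then show ?thesis
    using bump_has_derivative[of \<delta> \<tau> c] by (simp add: bump_frechet) (metis differentiable_def)
qed

lemma bump_nonneg: "0 \<le> bump \<delta> \<tau> c z"
  by (simp add: bump_def cutoff_nonneg)

lemma bump_ge_1:
  assumes "z \<in> cylinder \<alpha> \<delta> c"
  shows "1 \<le> bump \<delta> (\<delta> powr \<alpha>) c z"
proof -
  have z: "norm (fst z - fst c) < \<delta>" "\<bar>snd z - snd c\<bar> < \<delta> powr \<alpha>"
    using assms by (auto simp: cylinder_def dist_norm norm_minus_commute)
  then have "0 < \<delta>" using norm_ge_zero[of "fst z - fst c"] by linarith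
  have "(norm (fst z - fst c) / \<delta>)\<^sup>2 \<le> 1" "((snd z - snd c) / \<delta> powr \<alpha>)\<^sup>2 \<le> 1"
    using z \<open>0 < \<delta>\<close> by (auto simp: power_le_one abs_square_le_1)
  then show ?thesis
    unfolding bump_def by (intro mult_ge1_I cutoff_ge_1)
qed

lemma square_ratio_ge_2: "0 < b \<Longrightarrow> 2 * b \<le> a \<Longrightarrow> 2 \<le> (a / b)\<^sup>2" for a b :: real
  using power_mono[of 2 "a / b" 2] by (simp add: pos_le_divide_eq)

lemma bump_outside:
  assumes "0 < \<delta>" "0 < \<tau>" "z \<notin> ball (fst c) (2 * \<delta>) \<times> {snd c - 2 * \<tau> <..< snd c + 2 * \<tau>}"
  shows "bump \<delta> \<tau> c z = 0" "bump_deriv \<delta> \<tau> c z v = 0"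
proof -
  have "2 * \<delta> \<le> norm (fst z - fst c) \<or> 2 * \<tau> \<le> \<bar>snd z - snd c\<bar>"
    using assms(3) by (cases z) (auto simp: dist_norm norm_minus_commute)
  then have "2 \<le> (norm (fst z - fst c) / \<delta>)\<^sup>2 \<or> 2 \<le> ((snd z - snd c) / \<tau>)\<^sup>2"
    using square_ratio_ge_2[OF assms(1)] square_ratio_ge_2[OF assms(2), of "\<bar>snd z - snd c\<bar>"]
    by (auto simp: power_divide)
  then show "bump \<delta> \<tau> c z = 0" "bump_deriv \<delta> \<tau> c z v = 0"
    by (auto simp: bump_def bump_deriv_def cutoff_eq_0)
qed

lemma cutoff_slope_le: "0 \<le> y \<Longrightarrow> \<bar>max 0 (2 - y\<^sup>2) * y\<bar> \<le> 4" for y :: real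
proof (cases "y \<le> 2")
  case True
  moreover assume "0 \<le> y"
  ultimately show ?thesis
    using mult_mono[of "max 0 (2 - y\<^sup>2)" 2 y 2] by (simp add: abs_mult)
next
  case False
  then show ?thesis using power_mono[of 2 y 2] by simp
qed

lemma bump_deriv_bound:
  assumes "0 < \<delta>" "0 < \<tau>"
  shows "\<bar>time_deriv (bump \<delta> \<tau> c) z\<bar> \<le> 64 / \<tau>" "norm (space_grad (bump \<delta> \<tau> c) z) \<le> 64 / \<delta>"
proof -
  let ?X = "norm (fst z - fst c) / \<delta>" and ?Y = "(snd z - snd c) / \<tau>"
  have "time_deriv (bump \<delta> \<tau> c) z
      = - ((4 / \<tau>) * (cutoff (?X\<^sup>2) * (max 0 (2 - ?Y\<^sup>2) * ?Y)))"
    using assms by (simp add: time_deriv_def bump_frechet bump_deriv_def power2_eq_square)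
  also have "\<bar>\<dots>\<bar> = (4 / \<tau>) * (cutoff (?X\<^sup>2) * \<bar>max 0 (2 - \<bar>?Y\<bar>\<^sup>2) * \<bar>?Y\<bar>\<bar>)"
    using assms cutoff_nonneg by (simp add: abs_mult power_divide)
  also have "\<dots> \<le> (4 / \<tau>) * (4 * 4)"
    using assms by (intro mult_left_mono mult_mono cutoff_le cutoff_slope_le) auto
  finally show "\<bar>time_deriv (bump \<delta> \<tau> c) z\<bar> \<le> 64 / \<tau>" by simp
  have "space_grad (bump \<delta> \<tau> c) z = (\<Sum>i\<in>Basis. ((- 4 * max 0 (2 - ?X\<^sup>2) / \<delta>\<^sup>2 * cutoff (?Y\<^sup>2))
           * ((fst z - fst c) \<bullet> i)) *\<^sub>R i)"
    by (simp add: space_grad_def space_deriv_def bump_frechet bump_deriv_def mult_ac)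
  also have "\<dots> = (- 4 * max 0 (2 - ?X\<^sup>2) / \<delta>\<^sup>2 * cutoff (?Y\<^sup>2)) *\<^sub>R (fst z - fst c)"
    by (simp only: scaleR_scaleR[symmetric] scaleR_sum_right[symmetric] euclidean_representation)
  also have "norm \<dots> = (4 / \<delta>) * (\<bar>max 0 (2 - ?X\<^sup>2) * ?X\<bar> * cutoff (?Y\<^sup>2))"
    using assms cutoff_nonneg by (simp add: abs_mult power2_eq_square)
  also have "\<dots> \<le> (4 / \<delta>) * (4 * 4)"
    using assms cutoff_nonneg by (intro mult_left_mono mult_mono cutoff_le cutoff_slope_le) auto
  finally show "norm (space_grad (bump \<delta> \<tau> c) z) \<le> 64 / \<delta>" by simp
qed

lemma bump_derivs_outside:
  assumes "0 < \<delta>" "0 < \<tau>" "z \<notin> ball (fst c) (2 * \<delta>) \<times> {snd c - 2 * \<tau> <..< snd c + 2 * \<tau>}"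
  shows "time_deriv (bump \<delta> \<tau> c) z = 0" "space_grad (bump \<delta> \<tau> c) z = 0"
  using assms by (simp_all add: time_deriv_def space_grad_def space_deriv_def bump_frechet bump_outside)

section \<open>The energy flux through a cylinder\<close>

text \<open>Either \<open>|b| \<le> w\<^sup>2\<close>, and the pressure term is at most \<open>w\<^sup>3\<close>, or \<open>w < |b|\<^bsup>1/2\<^esup>\<close>, and it is at
  most \<open>|b|\<^bsup>3/2\<^esup>\<close>. Decoupling the pressure from the velocity in this way leaves only pure powers to
  be estimated.\<close>

lemma cubic_flux_le:
  fixes w b :: real
  assumes "0 \<le> w"
  shows "(w\<^sup>2 / 2 + \<bar>b\<bar>) * w \<le> 2 * w powr 3 + \<bar>b\<bar> powr (3 / 2)"
proof (cases "\<bar>b\<bar> \<le> w\<^sup>2")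
  case True
  then have "(w\<^sup>2 / 2 + \<bar>b\<bar>) * w \<le> (w\<^sup>2 / 2 + w\<^sup>2) * w"
    using assms by (intro mult_right_mono) auto
  also have "\<dots> \<le> 2 * w ^ 3" using assms by (simp add: power2_eq_square power3_eq_cube)
  finally show ?thesis using assms by (simp add: add_increasing2)
next
  case False
  then have "w \<le> sqrt \<bar>b\<bar>" by (simp add: real_le_rsqrt)
  then have "\<bar>b\<bar> * w \<le> \<bar>b\<bar> * \<bar>b\<bar> powr (1 / 2)"
    by (intro mult_left_mono) (auto simp: powr_half_sqrt)
  also have "\<dots> = \<bar>b\<bar> powr (3 / 2)"
    using powr_add[of "\<bar>b\<bar>" 1 "1 / 2"] by simp
  finally have "\<bar>b\<bar> * w \<le> \<bar>b\<bar> powr (3 / 2)" .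
  moreover have "w\<^sup>2 / 2 * w \<le> 2 * w powr 3"
    using assms by (simp add: power2_eq_square power3_eq_cube)
  ultimately show ?thesis by (simp add: distrib_right)
qed

text \<open>The bound holds even if the integrand of the energy pairing is not integrable, because the
  pairing is then zero by convention.\<close>

lemma energy_pairing_bound:
  fixes u :: "'a::euclidean_space \<times> real \<Rightarrow> 'a"
  assumes Q: "Q \<in> sets lebesgue" and W: "W \<in> sets lebesgue"
    and uv: "u \<in> borel_measurable (lebesgue_on Q)" "p \<in> borel_measurable (lebesgue_on Q)"
    and a: "0 \<le> a" "\<And>z. z \<in> Q \<Longrightarrow> \<bar>time_deriv \<phi> z\<bar> \<le> a"
    and b: "0 \<le> b" "\<And>z. z \<in> Q \<Longrightarrow> norm (space_grad \<phi> z) \<le> b"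
    and out: "\<And>z. z \<in> Q \<Longrightarrow> z \<notin> W \<Longrightarrow> time_deriv \<phi> z = 0"
      "\<And>z. z \<in> Q \<Longrightarrow> z \<notin> W \<Longrightarrow> space_grad \<phi> z = 0"
    and WQ: "W \<subseteq> Q"
  shows "ennreal \<bar>energy_pairing Q u p \<phi>\<bar>
    \<le> ennreal a * (\<integral>\<^sup>+z\<in>W. ennreal (norm (u z) powr 2) \<partial>lebesgue)
     + (ennreal (2 * b) * (\<integral>\<^sup>+z\<in>W. ennreal (norm (u z) powr 3) \<partial>lebesgue)
     + ennreal b * (\<integral>\<^sup>+z\<in>W. ennreal (norm (p z) powr (3 / 2)) \<partial>lebesgue))"
proof -
  let ?f = "\<lambda>z. (norm (u z))\<^sup>2 / 2 * time_deriv \<phi> z + energy_flux u p z \<bullet> space_grad \<phi> z"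
  let ?g = "\<lambda>z. ennreal a * ennreal (norm (u z) powr 2) + (ennreal (2 * b) * ennreal (norm (u z) powr 3)
     + ennreal b * ennreal (norm (p z) powr (3 / 2)))"
  have pt: "ennreal (norm (?f z)) \<le> ?g z * indicator W z" if z: "z \<in> Q" for z
  proof (cases "z \<in> W")
    case False
    then show ?thesis using z out by simp
  next
    case True
    have "norm (?f z) \<le> \<bar>(norm (u z))\<^sup>2 / 2 * time_deriv \<phi> z\<bar> + \<bar>energy_flux u p z \<bullet> space_grad \<phi> z\<bar>"
      by simp
    also have "\<bar>(norm (u z))\<^sup>2 / 2 * time_deriv \<phi> z\<bar> \<le> (norm (u z))\<^sup>2 * a"
      unfolding abs_mult using a z by (intro mult_mono) auto
    also have "\<bar>energy_flux u p z \<bullet> space_grad \<phi> z\<bar> \<le> norm (energy_flux u p z) * b"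
      using b z by (intro order_trans[OF Cauchy_Schwarz_ineq2] mult_left_mono) auto
    also have "norm (energy_flux u p z) \<le> ((norm (u z))\<^sup>2 / 2 + \<bar>p z\<bar>) * norm (u z)"
      unfolding energy_flux_def norm_scaleR real_norm_def
      by (intro mult_right_mono order_trans[OF abs_triangle_ineq]) auto
    also have "\<dots> \<le> 2 * norm (u z) powr 3 + \<bar>p z\<bar> powr (3 / 2)"
      by (rule cubic_flux_le) simp
    finally have "norm (?f z) \<le> a * norm (u z) powr 2
        + (2 * b * norm (u z) powr 3 + b * norm (p z) powr (3 / 2))"
      using b by (simp add: algebra_simps mult_right_mono)
    then have "ennreal (norm (?f z)) \<le> ennreal (a * norm (u z) powr 2
        + (2 * b * norm (u z) powr 3 + b * norm (p z) powr (3 / 2)))"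
      by (rule ennreal_leI)
    also have "\<dots> = ?g z"
      using a b by (simp add: ennreal_mult')
    finally show ?thesis using True by simp
  qed
  have "ennreal \<bar>energy_pairing Q u p \<phi>\<bar> \<le> (\<integral>\<^sup>+z. ennreal (norm (?f z)) \<partial>lebesgue_on Q)"
  proof (cases "integrable (lebesgue_on Q) ?f")
    case True
    then show ?thesis
      using integral_norm_bound_ennreal[OF True] by (simp add: energy_pairing_def)
  next
    case False
    then show ?thesis by (simp add: energy_pairing_def not_integrable_integral_eq)
  qed
  also have "\<dots> \<le> (\<integral>\<^sup>+z. ?g z * indicator W z \<partial>lebesgue_on Q)"
    using pt Q by (intro nn_integral_mono) auto
  also have "\<dots> = (\<integral>\<^sup>+z. ennreal a * (ennreal (norm (u z) powr 2) * indicator W z)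
     + (ennreal (2 * b) * (ennreal (norm (u z) powr 3) * indicator W z)
     + ennreal b * (ennreal (norm (p z) powr (3 / 2)) * indicator W z)) \<partial>lebesgue_on Q)"
    by (intro nn_integral_cong) (auto split: split_indicator)
  also have "\<dots> = ennreal a * (\<integral>\<^sup>+z\<in>W. ennreal (norm (u z) powr 2) \<partial>lebesgue_on Q)
     + (ennreal (2 * b) * (\<integral>\<^sup>+z\<in>W. ennreal (norm (u z) powr 3) \<partial>lebesgue_on Q)
     + ennreal b * (\<integral>\<^sup>+z\<in>W. ennreal (norm (p z) powr (3 / 2)) \<partial>lebesgue_on Q))"
  proof -
    note [measurable] = uv
    have [measurable]: "W \<in> sets (lebesgue_on Q)"
      using W WQ Q by (simp add: sets_restrict_space_iff)
    show ?thesis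
      by (simp add: nn_integral_add nn_integral_cmult)
  qed
  also have "\<dots> = ennreal a * (\<integral>\<^sup>+z\<in>W. ennreal (norm (u z) powr 2) \<partial>lebesgue)
     + (ennreal (2 * b) * (\<integral>\<^sup>+z\<in>W. ennreal (norm (u z) powr 3) \<partial>lebesgue)
     + ennreal b * (\<integral>\<^sup>+z\<in>W. ennreal (norm (p z) powr (3 / 2)) \<partial>lebesgue))"
  proof -
    have "(\<integral>\<^sup>+z\<in>W. F z \<partial>lebesgue_on Q) = (\<integral>\<^sup>+z\<in>W. F z \<partial>lebesgue)" for F
    using Q WQ by (subst nn_integral_restrict_space)
      (auto intro!: nn_integral_cong split: split_indicator)
    then show ?thesis by simp
  qed
  finally show ?thesis .
qed

section \<open>The scaling exponents\<close>

lemma holder_gain_finite: "p \<noteq> top \<Longrightarrow> holder_gain a p = 1 - a / enn2real p"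
  by (simp add: holder_gain_def)

text \<open>The pressure lies in a space of half the exponents and enters with half the power, so that it
  scales like the cube of the velocity.\<close>

lemma holder_gain_half: "holder_gain (3 / 2) (r / 2) = holder_gain 3 r"
  by (cases r) (auto simp: holder_gain_def ennreal_divide_numeral ennreal_top_divide)

lemma enn2real_ge_3: "3 \<le> r \<Longrightarrow> r \<noteq> top \<Longrightarrow> 3 \<le> enn2real r"
  by (cases r) (auto simp flip: ennreal_numeral)

text \<open>Here \<open>s\<close> and \<open>\<alpha>\<close> come from: after Hoelder on a cylinder of volume \<open>\<delta>\<^sup>d \<delta>\<^sup>\<alpha>\<close>, the term with
  \<open>\<partial>\<^sub>t\<phi>\<close> scales with the first exponent and the terms with \<open>\<nabla>\<phi>\<close> scale with the second. Equating
  them determines \<open>\<alpha>\<close>, and the common value is \<open>s\<close>.\<close>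

lemma scaling_exponents:
  fixes d :: nat
  assumes "3 \<le> r" "3 \<le> q"
  defines "\<alpha> \<equiv> time_exponent d r q"
  shows "real d * holder_gain 2 r + \<alpha> * holder_gain 2 q - \<alpha> = dissip_exponent d r q"
    and "real d * holder_gain 3 r + \<alpha> * holder_gain 3 q - 1 = dissip_exponent d r q"
proof -
  note ge = enn2real_ge_3[OF assms(1)] enn2real_ge_3[OF assms(2)]
  have *: "real d * holder_gain 2 r + \<alpha> * holder_gain 2 q - \<alpha> = dissip_exponent d r q \<and>
     real d * holder_gain 3 r + \<alpha> * holder_gain 3 q - 1 = dissip_exponent d r q"
  proof (cases "q = top")
    case True
    then show ?thesis using ge
      by (cases "r = top")
        (auto simp: \<alpha>_def time_exponent_def dissip_exponent_def holder_gain_def field_simps)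
  next
    case False
    define x where "x = enn2real q"
    define e where "e = (if r = top then 1 else (enn2real r + real d) / enn2real r)"
    have x: "3 \<le> x" using ge False by (simp add: x_def)
    have A: "\<alpha> = x / (x - 1) * e"
      and S: "dissip_exponent d r q = real d * (if r = top then 1 else (enn2real r - 2) / enn2real r)
        - 2 / (x - 1) * e"
      using False by (auto simp: \<alpha>_def time_exponent_def dissip_exponent_def x_def e_def)
    define X where "X = x / (x - 1)"
    have 2: "\<alpha> * holder_gain 2 q - \<alpha> = - (2 / (x - 1) * e)"
      and 3: "\<alpha> * holder_gain 3 q = e - 2 / (x - 1) * e"
    proof -
      have "x / (x - 1) = 1 + 1 / (x - 1)" "x / (x - 1) * (2 / x) = 2 / (x - 1)"
        "x / (x - 1) * (3 / x) = 3 / (x - 1)"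
        using x by (simp_all add: divide_simps)
      then have "x / (x - 1) * (1 - 2 / x) - x / (x - 1) = - (2 / (x - 1))"
        "x / (x - 1) * (1 - 3 / x) = 1 - 2 / (x - 1)"
        by (simp_all add: right_diff_distrib)
      moreover have "\<alpha> * holder_gain 2 q - \<alpha> = e * (x / (x - 1) * (1 - 2 / x) - x / (x - 1))"
        "\<alpha> * holder_gain 3 q = e * (x / (x - 1) * (1 - 3 / x))"
        using False unfolding A X_def[symmetric]
        by (simp_all add: holder_gain_finite algebra_simps flip: x_def)
      ultimately have "\<alpha> * holder_gain 2 q - \<alpha> = e * - (2 / (x - 1))"
        "\<alpha> * holder_gain 3 q = e * (1 - 2 / (x - 1))"
        by (simp_all only:)
      then show "\<alpha> * holder_gain 2 q - \<alpha> = - (2 / (x - 1) * e)"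
        "\<alpha> * holder_gain 3 q = e - 2 / (x - 1) * e"
        by (simp_all only: right_diff_distrib mult_minus_right mult.commute mult_1_right)
    qed
    have "real d * holder_gain 2 r = real d * (if r = top then 1 else (enn2real r - 2) / enn2real r)"
      "real d * holder_gain 3 r + e - 1 = real d * (if r = top then 1 else (enn2real r - 2) / enn2real r)"
      using ge by (auto simp: holder_gain_def e_def field_simps)
    with 2 3 S show ?thesis by linarith
  qed
  then show "real d * holder_gain 2 r + \<alpha> * holder_gain 2 q - \<alpha> = dissip_exponent d r q"
    "real d * holder_gain 3 r + \<alpha> * holder_gain 3 q - 1 = dissip_exponent d r q" by auto
qed

section \<open>The upper density of the dissipation measure\<close>

text \<open>An open box outside of which the test function vanishes, for the cylinder of radius \<open>\<delta>\<close>. Its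
  height is \<open>2\<delta>\<^sup>\<alpha>\<close> on either side and not \<open>(2\<delta>)\<^sup>\<alpha>\<close>.\<close>

definition cylinder_box :: "real \<Rightarrow> real \<Rightarrow> 'a::euclidean_space \<times> real \<Rightarrow> ('a \<times> real) set" where
  "cylinder_box \<alpha> \<delta> c =
     ball (fst c) (2 * \<delta>) \<times> {snd c - 2 * \<delta> powr \<alpha> <..< snd c + 2 * \<delta> powr \<alpha>}"

text \<open>The compact set \<open>K\<close> does two things: it makes the bump an admissible test function on \<open>X\<close>, and
  its finite measure makes the bump integrable, so that the Bochner integral in the energy identity
  is not a default value.\<close>

lemma emeasure_le_bump_integral:
  assumes \<epsilon>: "local_measure X \<epsilon>" and \<delta>: "0 < \<delta>"
    and K: "compact K" "K \<subseteq> X" "cylinder_box \<alpha> \<delta> c \<inter> X \<subseteq> K"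
  shows "bump \<delta> (\<delta> powr \<alpha>) c \<in> test_C 1 X"
    and "emeasure \<epsilon> (X \<inter> cylinder \<alpha> \<delta> c) \<le> ennreal (\<integral>z. bump \<delta> (\<delta> powr \<alpha>) c z \<partial>\<epsilon>)"
proof -
  let ?\<phi> = "bump \<delta> (\<delta> powr \<alpha>) c"
  have \<tau>: "0 < \<delta> powr \<alpha>" using \<delta> by simp
  have out: "?\<phi> z = 0" if "z \<in> X" "z \<notin> K" for z
    using that K(3) bump_outside(1)[OF \<delta> \<tau>, of z c] unfolding cylinder_box_def by blast
  then show "?\<phi> \<in> test_C 1 X"
    using bump_class_C[of \<delta> "\<delta> powr \<alpha>" c] K unfolding test_C_def by blast
  have sets_eq: "sets \<epsilon> = sets (restrict_space borel X)" and fin: "emeasure \<epsilon> K < top"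
    using \<epsilon> K by (auto simp: local_measure_def)
  have space_eq: "space \<epsilon> = X"
    using sets_eq_imp_space_eq[OF sets_eq] by (simp add: space_restrict_space)
  have cont: "continuous_on UNIV ?\<phi>"
    unfolding bump_def divide_inverse by (intro continuous_intros)
  then have "?\<phi> \<in> borel_measurable (restrict_space borel X)"
    by (intro measurable_restrict_space1 borel_measurable_continuous_onI)
  then have meas [measurable]: "?\<phi> \<in> borel_measurable \<epsilon>"
    using measurable_cong_sets[OF sets_eq refl] by blast
  have "open (cylinder \<alpha> \<delta> c)" unfolding cylinder_def by (intro open_Times) auto
  then have cyl: "X \<inter> cylinder \<alpha> \<delta> c \<in> sets \<epsilon>"
    unfolding sets_eq sets_restrict_space by auto
  have Kset: "K \<in> sets \<epsilon>"
    unfolding sets_eq sets_restrict_space using K compact_imp_closed[OF K(1)]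
    by (auto intro!: image_eqI[of _ _ K])
  have le16: "?\<phi> z \<le> 16" for z
    unfolding bump_def
    using mult_mono[OF cutoff_le[of "(norm (fst z - fst c) / \<delta>)\<^sup>2"]
        cutoff_le[of "((snd z - snd c) / \<delta> powr \<alpha>)\<^sup>2"]] cutoff_nonneg by simp
  have "(\<integral>\<^sup>+z. ennreal (?\<phi> z) \<partial>\<epsilon>) \<le> (\<integral>\<^sup>+z. 16 * indicator K z \<partial>\<epsilon>)"
    using out le16 space_eq
    by (intro nn_integral_mono) (auto split: split_indicator simp flip: ennreal_numeral intro!: ennreal_leI)
  also have "\<dots> < top"
    using Kset fin by (simp add: nn_integral_cmult_indicator ennreal_mult_less_top)
  finally have int: "integrable \<epsilon> ?\<phi>"
    by (intro integrableI_nonneg meas AE_I2 bump_nonneg) simp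
  have "emeasure \<epsilon> (X \<inter> cylinder \<alpha> \<delta> c) = (\<integral>\<^sup>+z. indicator (X \<inter> cylinder \<alpha> \<delta> c) z \<partial>\<epsilon>)"
    using cyl by simp
  also have "\<dots> \<le> (\<integral>\<^sup>+z. ennreal (?\<phi> z) \<partial>\<epsilon>)"
    by (intro nn_integral_mono) (auto split: split_indicator intro!: bump_ge_1)
  also have "\<dots> = ennreal (\<integral>z. ?\<phi> z \<partial>\<epsilon>)"
    by (intro nn_integral_eq_integral int AE_I2 bump_nonneg)
  finally show "emeasure \<epsilon> (X \<inter> cylinder \<alpha> \<delta> c) \<le> ennreal (\<integral>z. ?\<phi> z \<partial>\<epsilon>)" .
qed

text \<open>The constant depends on the norms over \<open>A \<times> J\<close> only, so it is uniform over all cylinders whose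
  doubled box meets the flow domain inside \<open>A \<times> J\<close>.\<close>

lemma dissipation_cylinder_bound:
  fixes u :: "'a::euclidean_space \<times> real \<Rightarrow> 'a" and A :: "'a set"
  assumes exps: "3 \<le> r" "3 \<le> q" "s = dissip_exponent DIM('a) r q" "\<alpha> = time_exponent DIM('a) r q"
    and u: "u \<in> borel_measurable (lebesgue_on (\<Omega> \<times> I))" "mixed_norm q J r A u < top"
    and p: "p \<in> borel_measurable (lebesgue_on (\<Omega> \<times> I))" "mixed_norm (q / 2) J (r / 2) A p < top"
    and sets: "\<Omega> \<in> sets borel" "I \<in> sets borel" "A \<in> sets borel" "J \<in> sets borel"
    and sub: "A \<subseteq> \<Omega>" "J \<subseteq> I"
    and \<epsilon>: "local_measure X \<epsilon>"
    and pairing: "\<And>\<phi>. \<phi> \<in> test_C 1 X \<Longrightarrow> energy_pairing (\<Omega> \<times> I) u p \<phi> = (\<integral>z. \<phi> z \<partial>\<epsilon>)"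
  shows "\<exists>C<top. \<forall>c \<delta> K. 0 < \<delta> \<and> compact K \<and> K \<subseteq> X \<and> cylinder_box \<alpha> \<delta> c \<inter> X \<subseteq> K \<and>
       cylinder_box \<alpha> \<delta> c \<inter> \<Omega> \<times> I \<subseteq> A \<times> J \<longrightarrow>
       emeasure \<epsilon> (X \<inter> cylinder \<alpha> \<delta> c) \<le> C * ennreal (\<delta> powr s)"
proof -
  define d where "d = DIM('a)"
  define V where "V = unit_ball_vol (real d) * 2 ^ d"
  have V: "0 < V" by (simp add: V_def)
  define k where "k a = V powr holder_gain a r * 4 powr holder_gain a q" for a
  define Nu where "Nu = mixed_norm q J r A u"
  define Np where "Np = mixed_norm (q / 2) J (r / 2) A p"
  define C where "C = ennreal (256 * k 2) * ennreal_powr Nu 2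
    + (ennreal (512 * k 3) * ennreal_powr Nu 3 + ennreal (256 * k 3) * ennreal_powr Np (3 / 2))"
  have C: "C < top"
    using u p by (simp add: C_def ennreal_mult_less_top ennreal_powr_less_top Nu_def Np_def)
  have scal: "(V * \<delta> ^ d) powr holder_gain a r * (4 * \<delta> powr \<alpha>) powr holder_gain a q
      = k a * \<delta> powr (real d * holder_gain a r + \<alpha> * holder_gain a q)" if "0 < \<delta>" for \<delta> a
    using that V by (simp add: k_def powr_mult powr_powr powr_add powr_realpow[symmetric])
  have half: "ennreal (3 / 2) \<le> x / 2" if "3 \<le> x" for x :: ennreal
    using divide_right_mono_ennreal[OF that, of 2] by (simp add: ennreal_divide_numeral[symmetric])
  have two: "ennreal 2 \<le> x" "ennreal 3 \<le> x" if "3 \<le> x" for x :: ennreal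
    using that order_trans[of 2 3 x] by auto
  have bound: "emeasure \<epsilon> (X \<inter> cylinder \<alpha> \<delta> c) \<le> C * ennreal (\<delta> powr s)"
    if \<delta>: "0 < \<delta>" and K: "compact K" "K \<subseteq> X" "cylinder_box \<alpha> \<delta> c \<inter> X \<subseteq> K"
      and AJ: "cylinder_box \<alpha> \<delta> c \<inter> \<Omega> \<times> I \<subseteq> A \<times> J" for c \<delta> K
  proof -
    let ?\<phi> = "bump \<delta> (\<delta> powr \<alpha>) c"
    have \<tau>: "0 < \<delta> powr \<alpha>" using \<delta> by simp
    \<comment> \<open>The part of the doubled box that lies in the flow domain is contained in \<open>B \<times> L\<close>.\<close>
    define B where "B = ball (fst c) (2 * \<delta>) \<inter> A"
    define L where "L = {snd c - 2 * \<delta> powr \<alpha> <..< snd c + 2 * \<delta> powr \<alpha>} \<inter> J"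
    have borel: "B \<in> sets borel" "L \<in> sets borel" "B \<times> L \<in> sets borel"
      "\<Omega> \<times> I \<in> sets borel"
      using sets by (auto simp: B_def L_def intro!: borel_Times)
    have W: "B \<times> L \<subseteq> \<Omega> \<times> I" using sub by (auto simp: B_def L_def)
    have out: "time_deriv ?\<phi> z = 0" "space_grad ?\<phi> z = 0" if "z \<in> \<Omega> \<times> I" "z \<notin> B \<times> L" for z
    proof -
      have "z \<notin> ball (fst c) (2 * \<delta>) \<times> {snd c - 2 * \<delta> powr \<alpha> <..< snd c + 2 * \<delta> powr \<alpha>}"
        using that AJ by (auto simp: B_def L_def cylinder_box_def)
      then show "time_deriv ?\<phi> z = 0" "space_grad ?\<phi> z = 0"
        by (rule bump_derivs_outside[OF \<delta> \<tau>])+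
    qed
    have "emeasure lebesgue B \<le> emeasure lebesgue (ball (fst c) (2 * \<delta>))"
      using borel by (intro emeasure_mono) (auto simp: B_def)
    also have "\<dots> = ennreal (V * \<delta> ^ d)"
      using \<delta> by (simp add: emeasure_ball V_def d_def power_mult_distrib mult_ac)
    finally have Bm: "emeasure lebesgue B \<le> ennreal (V * \<delta> ^ d)" .
    have "emeasure lebesgue L \<le> emeasure lebesgue {snd c - 2 * \<delta> powr \<alpha> <..< snd c + 2 * \<delta> powr \<alpha>}"
      using borel by (intro emeasure_mono) (auto simp: L_def)
    also have "\<dots> = ennreal (4 * \<delta> powr \<alpha>)" by simp
    finally have Lm: "emeasure lebesgue L \<le> ennreal (4 * \<delta> powr \<alpha>)" .
    have mh: "(\<integral>\<^sup>+z\<in>B \<times> L. ennreal (norm (f z) powr a) \<partial>lebesgue)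
      \<le> ennreal (4 * ((V * \<delta> ^ d) powr holder_gain a \<rho> * (4 * \<delta> powr \<alpha>) powr holder_gain a \<kappa>))
          * ennreal_powr (mixed_norm \<kappa> J \<rho> A f) a"
      if "f \<in> borel_measurable (lebesgue_on (\<Omega> \<times> I))" "0 < a" "ennreal a \<le> \<rho>" "ennreal a \<le> \<kappa>"
      for f :: "'a \<times> real \<Rightarrow> 'b::euclidean_space" and a \<rho> \<kappa>
      using that borel sets sub Bm Lm V \<delta>
      by (intro mixed_holder[of f \<Omega> I]) (auto simp: B_def L_def)
    have e2: "real d * holder_gain 2 r + \<alpha> * holder_gain 2 q = s + \<alpha>"
      using scaling_exponents(1)[OF exps(1,2), of d] exps by (simp add: d_def)
    have I2: "(\<integral>\<^sup>+z\<in>B \<times> L. ennreal (norm (u z) powr 2) \<partial>lebesgue)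
       \<le> ennreal (4 * (k 2 * \<delta> powr (s + \<alpha>))) * ennreal_powr Nu 2"
      using mh[OF u(1), of 2 r q] two exps(1,2) by (simp add: scal[OF \<delta>] Nu_def e2)
    have e3: "real d * holder_gain 3 r + \<alpha> * holder_gain 3 q = s + 1"
      using scaling_exponents(2)[OF exps(1,2), of d] exps by (simp add: d_def)
    have I3: "(\<integral>\<^sup>+z\<in>B \<times> L. ennreal (norm (u z) powr 3) \<partial>lebesgue)
       \<le> ennreal (4 * (k 3 * \<delta> powr (s + 1))) * ennreal_powr Nu 3"
      using mh[OF u(1), of 3 r q] two exps(1,2) by (simp add: scal[OF \<delta>] Nu_def e3)
    have Ip: "(\<integral>\<^sup>+z\<in>B \<times> L. ennreal (norm (p z) powr (3 / 2)) \<partial>lebesgue)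
       \<le> ennreal (4 * (k 3 * \<delta> powr (s + 1))) * ennreal_powr Np (3 / 2)"
      using mh[OF p(1), of "3 / 2" "r / 2" "q / 2"] half exps(1,2)
      by (simp add: holder_gain_half scal[OF \<delta>] Np_def e3)
    have "emeasure \<epsilon> (X \<inter> cylinder \<alpha> \<delta> c) \<le> ennreal (energy_pairing (\<Omega> \<times> I) u p ?\<phi>)"
      using emeasure_le_bump_integral[OF \<epsilon> \<delta> K] pairing by simp
    also have "\<dots> \<le> ennreal \<bar>energy_pairing (\<Omega> \<times> I) u p ?\<phi>\<bar>"
      by (intro ennreal_leI) simp
    also have "\<dots> \<le> ennreal (64 / \<delta> powr \<alpha>) * (\<integral>\<^sup>+z\<in>B \<times> L. ennreal (norm (u z) powr 2) \<partial>lebesgue)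
     + (ennreal (2 * (64 / \<delta>)) * (\<integral>\<^sup>+z\<in>B \<times> L. ennreal (norm (u z) powr 3) \<partial>lebesgue)
     + ennreal (64 / \<delta>) * (\<integral>\<^sup>+z\<in>B \<times> L. ennreal (norm (p z) powr (3 / 2)) \<partial>lebesgue))"
      using borel W \<delta> \<tau> u(1) p(1)
      by (intro energy_pairing_bound out bump_deriv_bound) auto
    also have "\<dots> \<le> ennreal (64 / \<delta> powr \<alpha>) * (ennreal (4 * (k 2 * \<delta> powr (s + \<alpha>))) * ennreal_powr Nu 2)
     + (ennreal (2 * (64 / \<delta>)) * (ennreal (4 * (k 3 * \<delta> powr (s + 1))) * ennreal_powr Nu 3)
     + ennreal (64 / \<delta>) * (ennreal (4 * (k 3 * \<delta> powr (s + 1))) * ennreal_powr Np (3 / 2)))"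
      by (intro add_mono mult_left_mono I2 I3 Ip) auto
    also have "\<dots> = C * ennreal (\<delta> powr s)"
    proof -
      have m: "ennreal x * (ennreal y * N) = ennreal (x * y) * N" if "0 \<le> x" for x y N
        using that by (simp add: ennreal_mult' mult.assoc)
      have "64 / \<delta> powr \<alpha> * (4 * (k 2 * \<delta> powr (s + \<alpha>))) = 256 * k 2 * \<delta> powr s"
        "2 * (64 / \<delta>) * (4 * (k 3 * \<delta> powr (s + 1))) = 512 * k 3 * \<delta> powr s"
        "64 / \<delta> * (4 * (k 3 * \<delta> powr (s + 1))) = 256 * k 3 * \<delta> powr s"
        using \<delta> by (simp_all add: powr_add)
      moreover have "ennreal (x * \<delta> powr s) * N = ennreal x * N * ennreal (\<delta> powr s)"
        if "0 \<le> x" for x N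
        using that by (simp add: ennreal_mult' mult_ac)
      moreover have "0 \<le> 256 * k 2" "0 \<le> 512 * k 3" "0 \<le> 256 * k 3" by (simp_all add: k_def)
      moreover have "0 \<le> 64 / \<delta> powr \<alpha>" "0 \<le> 2 * (64 / \<delta>)" "0 \<le> 64 / \<delta>" using \<delta> by simp_all
      ultimately show ?thesis
        by (simp only: m C_def distrib_right)
    qed
    finally show ?thesis .
  qed
  show ?thesis using C bound by blast
qed

section \<open>Null sets of the anisotropic Hausdorff measure\<close>

lemma infsum_ennreal_ge_suminf:
  fixes f :: "nat \<Rightarrow> ennreal"
  shows "(\<Sum>i. if i \<in> I then f i else 0) \<le> (\<Sum>\<^sub>\<infinity>i\<in>I. f i)"
proof (rule suminf_le_const)
  fix n
  have "(\<Sum>i<n. if i \<in> I then f i else 0) = (\<Sum>\<^sub>\<infinity>i\<in>{..<n} \<inter> I. f i)"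
    by (simp add: sum.inter_restrict)
  also have "\<dots> \<le> (\<Sum>\<^sub>\<infinity>i\<in>I. f i)"
    by (rule infsum_mono_neutral) (auto intro: nonneg_summable_on_complete)
  finally show "(\<Sum>i<n. if i \<in> I then f i else 0) \<le> (\<Sum>\<^sub>\<infinity>i\<in>I. f i)" .
qed simp

text \<open>Covers are restricted by diameter, the density bound by radius; this passes from one to the
  other.\<close>

lemma diameter_cylinder_ge:
  assumes "0 < \<delta>"
  shows "\<delta> / 2 \<le> diameter (cylinder \<alpha> \<delta> c)"
proof -
  obtain b :: 'a where b: "b \<in> Basis" using nonempty_Basis by blast
  have "bounded (cylinder \<alpha> \<delta> c)"
    unfolding cylinder_def by (intro bounded_Times) auto
  moreover have "c \<in> cylinder \<alpha> \<delta> c" "(fst c + (\<delta> / 2) *\<^sub>R b, snd c) \<in> cylinder \<alpha> \<delta> c"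
    using assms b by (cases c; auto simp: cylinder_def dist_norm)+
  ultimately have "dist c (fst c + (\<delta> / 2) *\<^sub>R b, snd c) \<le> diameter (cylinder \<alpha> \<delta> c)"
    by (rule diameter_bounded_bound)
  then show ?thesis using assms b by (cases c) (simp add: dist_norm norm_Pair)
qed

lemma aniso_premeasure_le:
  fixes I :: "nat set"
  assumes "\<And>i. i \<in> I \<Longrightarrow> 0 < \<delta> i \<and> diameter (cylinder \<alpha> (\<delta> i) (z i)) \<le> \<rho>"
    "A \<subseteq> (\<Union>i\<in>I. cylinder \<alpha> (\<delta> i) (z i))"
  shows "aniso_premeasure \<alpha> s \<rho> A \<le> (\<Sum>\<^sub>\<infinity>i\<in>I. ennreal (\<delta> i powr s))"
  unfolding aniso_premeasure_def
  by (rule Inf_lower, rule CollectI, rule exI[of _ I], rule exI[of _ \<delta>], rule exI[of _ z])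
     (use assms in simp)

lemma aniso_premeasure_greatest:
  assumes "\<And>(I :: nat set) \<delta> z. (\<And>i. i \<in> I \<Longrightarrow> 0 < \<delta> i \<and> diameter (cylinder \<alpha> (\<delta> i) (z i)) \<le> \<rho>) \<Longrightarrow>
    A \<subseteq> (\<Union>i\<in>I. cylinder \<alpha> (\<delta> i) (z i)) \<Longrightarrow> v \<le> (\<Sum>\<^sub>\<infinity>i\<in>I. ennreal (\<delta> i powr s))"
  shows "v \<le> aniso_premeasure \<alpha> s \<rho> A"
  unfolding aniso_premeasure_def
proof (rule Inf_greatest, elim CollectE exE conjE)
  fix w I \<delta> and z :: "nat \<Rightarrow> 'a \<times> real"
  assume "w = (\<Sum>\<^sub>\<infinity>i\<in>(I::nat set). ennreal (\<delta> i powr s))"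
    "\<forall>i\<in>I. 0 < \<delta> i \<and> diameter (cylinder \<alpha> (\<delta> i) (z i)) \<le> \<rho>"
    "A \<subseteq> (\<Union>i\<in>I. cylinder \<alpha> (\<delta> i) (z i))"
  then show "v \<le> w" using assms[of I \<delta> z] by simp
qed

lemma aniso_hausdorff_0_iff: "aniso_hausdorff \<alpha> s A = 0 \<longleftrightarrow> (\<forall>\<rho>>0. aniso_premeasure \<alpha> s \<rho> A = 0)"
  by (auto simp: aniso_hausdorff_eq_SUP SUP_eq_iff)

lemma aniso_hausdorff_0_cover:
  assumes "aniso_hausdorff \<alpha> s A = 0" "0 < \<rho>" "0 < e"
  obtains I :: "nat set" and \<delta> z where "\<And>i. i \<in> I \<Longrightarrow> 0 < \<delta> i \<and> \<delta> i < \<rho>"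
    "A \<subseteq> (\<Union>i\<in>I. cylinder \<alpha> (\<delta> i) (z i))" "(\<Sum>\<^sub>\<infinity>i\<in>I. ennreal (\<delta> i powr s)) < e"
proof -
  have "aniso_premeasure \<alpha> s (\<rho> / 4) A < e"
    using assms by (simp add: aniso_hausdorff_0_iff)
  then obtain I :: "nat set" and \<delta> z where I:
    "\<forall>i\<in>I. 0 < \<delta> i \<and> diameter (cylinder \<alpha> (\<delta> i) (z i)) \<le> \<rho> / 4"
    "A \<subseteq> (\<Union>i\<in>I. cylinder \<alpha> (\<delta> i) (z i))" "(\<Sum>\<^sub>\<infinity>i\<in>I. ennreal (\<delta> i powr s)) < e"
    unfolding aniso_premeasure_def Inf_less_iff by blast
  have "0 < \<delta> i \<and> \<delta> i < \<rho>" if "i \<in> I" for i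
  proof -
    have "0 < \<delta> i" "diameter (cylinder \<alpha> (\<delta> i) (z i)) \<le> \<rho> / 4" using I(1) that by auto
    moreover from this have "\<delta> i / 2 \<le> \<rho> / 4"
      using diameter_cylinder_ge[of "\<delta> i" \<alpha> "z i"] by linarith
    ultimately show ?thesis using assms(2) by linarith
  qed
  with I(2,3) show ?thesis by (rule that[rotated]) auto
qed

text \<open>Of a cover of \<open>A\<close> only the cylinders meeting \<open>U\<close> are kept; they still cover \<open>A \<inter> U\<close> and obey
  the density bound, so the mass of \<open>A \<inter> U\<close> is at most \<open>C \<Sum> \<delta>\<^sub>i\<^sup>s\<close>, which can be made arbitrarily
  small.\<close>

lemma null_if_density_bound:
  fixes X :: "('a::euclidean_space \<times> real) set"
  assumes sets_eq: "sets \<epsilon> = sets (restrict_space borel X)"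
    and A: "A \<in> sets \<epsilon>" "aniso_hausdorff \<alpha> s A = 0"
    and U: "open U" "0 < \<rho>" "C < top"
    and dens: "\<And>c \<delta>. 0 < \<delta> \<Longrightarrow> \<delta> < \<rho> \<Longrightarrow> cylinder \<alpha> \<delta> c \<inter> U \<noteq> {} \<Longrightarrow>
        emeasure \<epsilon> (X \<inter> cylinder \<alpha> \<delta> c) \<le> C * ennreal (\<delta> powr s)"
  shows "A \<inter> U \<in> null_sets \<epsilon>"
proof -
  have AX: "A \<subseteq> X"
    using sets.sets_into_space[OF A(1)] sets_eq_imp_space_eq[OF sets_eq]
    by (simp add: space_restrict_space)
  have open_in: "X \<inter> V \<in> sets \<epsilon>" if "open V" for V
    unfolding sets_eq sets_restrict_space using that by auto
  have AU: "A \<inter> U \<in> sets \<epsilon>"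
    using sets.Int[OF A(1) open_in[OF U(1)]] AX by (simp add: Int_absorb2 Int_assoc[symmetric])
  obtain k where k: "C = ennreal k" "0 \<le> k" using U(3) by (cases C) auto
  have small: "emeasure \<epsilon> (A \<inter> U) \<le> 0 + ennreal e" if e: "0 < e" for e
  proof -
    \<comment> \<open>Dividing by \<open>k + 1\<close> instead of \<open>k\<close> covers the case of a vanishing density constant.\<close>
    have "0 < ennreal (e / (k + 1))" using e k by simp
    from aniso_hausdorff_0_cover[OF A(2) U(2) this]
    obtain I :: "nat set" and \<delta> z where I: "\<And>i. i \<in> I \<Longrightarrow> 0 < \<delta> i \<and> \<delta> i < \<rho>"
      "A \<subseteq> (\<Union>i\<in>I. cylinder \<alpha> (\<delta> i) (z i))"
      "(\<Sum>\<^sub>\<infinity>i\<in>I. ennreal (\<delta> i powr s)) < ennreal (e / (k + 1))" by blast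
    define F where "F i = (if i \<in> I \<and> cylinder \<alpha> (\<delta> i) (z i) \<inter> U \<noteq> {}
        then X \<inter> cylinder \<alpha> (\<delta> i) (z i) else {})" for i
    have "open (cylinder \<alpha> t c)" for t and c :: "'a \<times> real"
      unfolding cylinder_def by (intro open_Times) auto
    from open_in[OF this] have F: "range F \<subseteq> sets \<epsilon>"
      by (simp add: F_def image_subset_iff)
    have "A \<inter> U \<subseteq> (\<Union>i. F i)"
    proof
      fix y assume y: "y \<in> A \<inter> U"
      then obtain i where "i \<in> I" "y \<in> cylinder \<alpha> (\<delta> i) (z i)" using I(2) by blast
      then have "y \<in> F i" using y AX by (auto simp: F_def)
      then show "y \<in> (\<Union>i. F i)" by blast
    qed
    then have "emeasure \<epsilon> (A \<inter> U) \<le> emeasure \<epsilon> (\<Union>i. F i)"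
      using F by (intro emeasure_mono) auto
    also have "\<dots> \<le> (\<Sum>i. emeasure \<epsilon> (F i))"
      by (rule emeasure_subadditive_countably[OF F])
    also have "\<dots> \<le> (\<Sum>i. C * (if i \<in> I then ennreal (\<delta> i powr s) else 0))"
      using dens I(1) by (intro suminf_le) (auto simp: F_def)
    also have "\<dots> = C * (\<Sum>i. if i \<in> I then ennreal (\<delta> i powr s) else 0)" by simp
    also have "\<dots> \<le> C * ennreal (e / (k + 1))"
      using I(3) infsum_ennreal_ge_suminf[of I "\<lambda>i. ennreal (\<delta> i powr s)"]
      by (intro mult_left_mono) auto
    also have "\<dots> = ennreal (k * (e / (k + 1)))"
      unfolding k(1) by (rule ennreal_mult'[OF k(2), symmetric])
    also have "\<dots> \<le> ennreal e"
      using e k by (intro ennreal_leI) (simp add: field_simps)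
    finally show ?thesis by simp
  qed
  have "emeasure \<epsilon> (A \<inter> U) \<le> 0" by (rule ennreal_le_epsilon) (rule small)
  then show ?thesis using AU by (simp add: null_sets_def)
qed

text \<open>By the Lindelof property countably many of the neighbourhoods cover \<open>X\<close>, which localises the
  density bound and its constant.\<close>

lemma abs_cont_if_locally_density_bound:
  assumes sets_eq: "sets \<epsilon> = sets (restrict_space borel X)"
    and loc: "\<And>z. z \<in> X \<Longrightarrow> \<exists>U \<rho> C. open U \<and> z \<in> U \<and> 0 < \<rho> \<and> C < top \<and>
       (\<forall>c \<delta>. 0 < \<delta> \<and> \<delta> < \<rho> \<and> cylinder \<alpha> \<delta> c \<inter> U \<noteq> {} \<longrightarrow>
          emeasure \<epsilon> (X \<inter> cylinder \<alpha> \<delta> c) \<le> C * ennreal (\<delta> powr s))"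
  shows "abs_cont_aniso_hausdorff \<epsilon> \<alpha> s"
  unfolding abs_cont_aniso_hausdorff_def
proof (intro ballI impI)
  fix A assume A: "A \<in> sets \<epsilon>" "aniso_hausdorff \<alpha> s A = 0"
  have AX: "A \<subseteq> X"
    using sets.sets_into_space[OF A(1)] sets_eq_imp_space_eq[OF sets_eq]
    by (simp add: space_restrict_space)
  define \<U> where "\<U> = {U. open U \<and> A \<inter> U \<in> null_sets \<epsilon>}"
  have "X \<subseteq> \<Union>\<U>"
  proof
    fix z assume "z \<in> X"
    from loc[OF this] obtain U \<rho> C where U: "open U" "z \<in> U" "0 < \<rho>" "C < top"
      "\<forall>c \<delta>. 0 < \<delta> \<and> \<delta> < \<rho> \<and> cylinder \<alpha> \<delta> c \<inter> U \<noteq> {} \<longrightarrow>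
        emeasure \<epsilon> (X \<inter> cylinder \<alpha> \<delta> c) \<le> C * ennreal (\<delta> powr s)"
      by (elim exE conjE) (rule that)
    have "A \<inter> U \<in> null_sets \<epsilon>"
      by (rule null_if_density_bound[OF sets_eq A U(1,3,4)]) (simp add: U(5))
    then have "U \<in> \<U>" using U(1) by (simp add: \<U>_def)
    then show "z \<in> \<Union>\<U>" using U(2) by blast
  qed
  moreover obtain \<V> where \<V>: "\<V> \<subseteq> \<U>" "countable \<V>" "\<Union>\<V> = \<Union>\<U>"
    using Lindelof[of \<U>] by (auto simp: \<U>_def)
  ultimately have "A \<subseteq> \<Union>\<V>" using AX by simp
  then have "A = (\<Union>U\<in>\<V>. A \<inter> U)" by blast
  moreover have "(\<Union>U\<in>\<V>. A \<inter> U) \<in> null_sets \<epsilon>"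
    using \<V> by (intro null_sets_UN') (auto simp: \<U>_def)
  ultimately show "emeasure \<epsilon> A = 0" by auto
qed

lemma aniso_hausdorff_0_subset:
  assumes "aniso_hausdorff \<alpha> s B = 0" "A \<subseteq> B"
  shows "aniso_hausdorff \<alpha> s A = 0"
proof -
  have "aniso_premeasure \<alpha> s \<rho> A \<le> aniso_premeasure \<alpha> s \<rho> B" for \<rho>
    by (rule aniso_premeasure_greatest, rule aniso_premeasure_le) (use assms(2) in auto)
  then have "aniso_premeasure \<alpha> s \<rho> A \<le> 0" if "0 < \<rho>" for \<rho>
    using assms(1) that by (metis aniso_hausdorff_0_iff)
  then show ?thesis by (simp add: aniso_hausdorff_0_iff)
qed

text \<open>For radii at most \<open>1\<close> the gauge \<open>\<delta>\<^sup>s\<close> decreases with \<open>s\<close>; covers of diameter at most \<open>1/2\<close>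
  consist of such cylinders.\<close>

lemma aniso_hausdorff_0_mono:
  assumes 0: "aniso_hausdorff \<alpha> s A = 0" and "s \<le> s'"
  shows "aniso_hausdorff \<alpha> s' A = 0"
proof -
  have "aniso_premeasure \<alpha> s' \<rho> A \<le> 0" if "0 < \<rho>" for \<rho>
  proof -
    have "aniso_premeasure \<alpha> s' \<rho> A \<le> aniso_premeasure \<alpha> s' (min \<rho> (1 / 2)) A"
      by (rule aniso_premeasure_antimono) simp
    also have "\<dots> \<le> aniso_premeasure \<alpha> s (min \<rho> (1 / 2)) A"
    proof (rule aniso_premeasure_greatest)
      fix I :: "nat set" and \<delta> :: "nat \<Rightarrow> real" and z :: "nat \<Rightarrow> 'a \<times> real"
      assume I: "\<And>i. i \<in> I \<Longrightarrow> 0 < \<delta> i \<and> diameter (cylinder \<alpha> (\<delta> i) (z i)) \<le> min \<rho> (1 / 2)"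
        "A \<subseteq> (\<Union>i\<in>I. cylinder \<alpha> (\<delta> i) (z i))"
      have le: "\<delta> i powr s' \<le> \<delta> i powr s" if "i \<in> I" for i
      proof -
        have "0 < \<delta> i" "diameter (cylinder \<alpha> (\<delta> i) (z i)) \<le> 1 / 2"
          using I(1)[OF that] by auto
        moreover from this have "\<delta> i \<le> 1"
          using diameter_cylinder_ge[of "\<delta> i" \<alpha> "z i"] by linarith
        ultimately show ?thesis using assms(2) by (intro powr_mono') auto
      qed
      have "aniso_premeasure \<alpha> s' (min \<rho> (1 / 2)) A \<le> (\<Sum>\<^sub>\<infinity>i\<in>I. ennreal (\<delta> i powr s'))"
        using I by (rule aniso_premeasure_le)
      also have "\<dots> \<le> (\<Sum>\<^sub>\<infinity>i\<in>I. ennreal (\<delta> i powr s))"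
        by (intro infsum_mono ennreal_leI nonneg_summable_on_complete le) auto
      finally show "aniso_premeasure \<alpha> s' (min \<rho> (1 / 2)) A \<le> (\<Sum>\<^sub>\<infinity>i\<in>I. ennreal (\<delta> i powr s))" .
    qed
    also have "\<dots> = 0" using 0 that by (simp add: aniso_hausdorff_0_iff)
    finally show ?thesis .
  qed
  then show ?thesis by (simp add: aniso_hausdorff_0_iff)
qed

lemma aniso_dim_ge_if_abs_cont:
  assumes sets_eq: "sets \<epsilon> = sets (restrict_space borel X)"
    and ac: "abs_cont_aniso_hausdorff \<epsilon> \<alpha> s"
    and pos: "emeasure \<epsilon> (space \<epsilon>) \<noteq> 0" and S: "concentrated_on \<epsilon> S"
  shows "ereal s \<le> aniso_dim \<alpha> S"
proof (rule ccontr)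
  assume "\<not> ?thesis"
  then obtain s' where s': "s' < s" "aniso_hausdorff \<alpha> s' S = 0"
    unfolding aniso_dim_def not_le Inf_less_iff by auto
  have "aniso_hausdorff \<alpha> s (space \<epsilon> \<inter> S) = 0"
    using aniso_hausdorff_0_subset[OF aniso_hausdorff_0_mono[OF s'(2)]] s'(1) by simp
  moreover have "space \<epsilon> = X"
    using sets_eq_imp_space_eq[OF sets_eq] by (simp add: space_restrict_space)
  then have "space \<epsilon> \<inter> S \<in> sets \<epsilon>"
    using S unfolding sets_eq sets_restrict_space concentrated_on_def by auto
  ultimately have "emeasure \<epsilon> (space \<epsilon> \<inter> S) = 0"
    using ac by (simp add: abs_cont_aniso_hausdorff_def)
  then show False using S pos by (simp add: concentrated_on_def)
qed

section \<open>Interior and boundary dissipation\<close>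

lemma cylinder_box_near:
  assumes \<delta>: "0 < \<delta>" "\<delta> \<le> R" "\<delta> powr \<alpha> \<le> R"
    and meet: "cylinder \<alpha> \<delta> c \<inter> ball x R \<times> {t - R <..< t + R} \<noteq> {}"
  shows "cylinder_box \<alpha> \<delta> c \<subseteq> cball x (4 * R) \<times> {t - 4 * R .. t + 4 * R}"
proof
  fix z assume z: "z \<in> cylinder_box \<alpha> \<delta> c"
  obtain w where w: "dist (fst c) (fst w) < \<delta>" "\<bar>snd c - snd w\<bar> < \<delta> powr \<alpha>"
    "dist x (fst w) < R" "\<bar>t - snd w\<bar> < R"
  proof -
    from meet obtain w where "w \<in> cylinder \<alpha> \<delta> c" "w \<in> ball x R \<times> {t - R <..< t + R}" by blast
    then show ?thesis
      by (intro that[of w]) (simp_all add: cylinder_def mem_Times_iff abs_less_iff)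
  qed
  have z': "dist (fst c) (fst z) < 2 * \<delta>" "\<bar>snd c - snd z\<bar> < 2 * \<delta> powr \<alpha>"
    using z by (auto simp: cylinder_box_def)
  have "dist x (fst z) \<le> dist x (fst w) + dist (fst c) (fst w) + dist (fst c) (fst z)"
    using dist_triangle[of x "fst z" "fst w"] dist_triangle[of "fst w" "fst z" "fst c"]
    by (simp add: dist_commute)
  then have "dist x (fst z) \<le> 4 * R" using w z' \<delta> by linarith
  moreover have "\<bar>t - snd z\<bar> \<le> 4 * R" using w z' \<delta> by linarith
  ultimately show "z \<in> cball x (4 * R) \<times> {t - 4 * R .. t + 4 * R}"
    by (cases z) (auto simp: abs_le_iff)
qed

lemma small_radius:
  fixes R :: real
  assumes "0 < \<alpha>" "0 < R" "0 < \<delta>" "\<delta> < R powr (1 / \<alpha>)"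
  shows "\<delta> powr \<alpha> \<le> R"
proof -
  have "\<delta> powr \<alpha> \<le> (R powr (1 / \<alpha>)) powr \<alpha>"
    by (rule powr_mono2) (use assms in auto)
  also have "\<dots> = R powr 1" unfolding powr_powr using assms(1) by simp
  finally show ?thesis using assms(2) by simp
qed

text \<open>Around an interior point, a compact cylinder inside \<open>\<Omega> \<times> (0,T)\<close> serves both as the region of finite
  norms and as the compact set carrying the test functions.\<close>

lemma local_dissipation_abs_cont:
  fixes \<Omega> :: "'a::euclidean_space set"
  assumes \<Omega>: "open \<Omega>"
    and exps: "3 \<le> r" "3 \<le> q" "s = dissip_exponent DIM('a) r q" "\<alpha> = time_exponent DIM('a) r q" "0 < \<alpha>"
    and u: "u \<in> mixed_space_loc q {0<..<T} r \<Omega>"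
    and p: "p \<in> mixed_space_loc (q / 2) {0<..<T} (r / 2) \<Omega>"
    and diss: "local_dissipation \<Omega> T u p \<epsilon>"
  shows "abs_cont_aniso_hausdorff \<epsilon> \<alpha> s"
proof -
  let ?Q = "\<Omega> \<times> {0<..<T}"
  have \<epsilon>: "local_measure ?Q \<epsilon>"
    and pairing: "\<And>\<phi>. \<phi> \<in> test_C 1 ?Q \<Longrightarrow> energy_pairing ?Q u p \<phi> = (\<integral>z. \<phi> z \<partial>\<epsilon>)"
    using diss by (simp_all add: local_dissipation_def Let_def)
  have "sets \<epsilon> = sets (restrict_space borel ?Q)" using \<epsilon> by (simp add: local_measure_def)
  then show ?thesis
  proof (rule abs_cont_if_locally_density_bound)
    fix z assume "z \<in> ?Q"
    then have x: "fst z \<in> \<Omega>" and t: "0 < snd z" "snd z < T" by auto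
    obtain R0 where R0: "0 < R0" "cball (fst z) R0 \<subseteq> \<Omega>"
      using \<Omega> x open_contains_cball by blast
    \<comment> \<open>Cylinders of radius and half-height at most \<open>R\<close> meeting the \<open>R\<close>-neighbourhood of \<open>z\<close> have
      their doubled box within distance \<open>R + R + 2R\<close> of \<open>z\<close>.\<close>
    define R where "R = min (R0 / 4) (min (snd z / 8) ((T - snd z) / 8))"
    have R: "0 < R" using R0 t by (simp add: R_def)
    define A where "A = cball (fst z) (4 * R)"
    define J where "J = {snd z - 4 * R .. snd z + 4 * R}"
    have A: "compact A" "A \<subseteq> \<Omega>"
    proof -
      have "4 * R \<le> R0" by (simp add: R_def min_def)
      then show "A \<subseteq> \<Omega>" using subset_cball R0(2) unfolding A_def by blast
    qed (simp add: A_def)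
    have J: "compact J" "J \<subseteq> {0<..<T}"
    proof -
      have "8 * R \<le> snd z" "8 * R \<le> T - snd z" by (simp_all add: R_def min_def)
      then show "J \<subseteq> {0<..<T}" using R t by (auto simp: J_def)
    qed (simp add: J_def)
    have K: "compact (A \<times> J)" "A \<times> J \<subseteq> ?Q"
      using A J by (auto intro: compact_Times)
    have "\<exists>C<top. \<forall>c \<delta> K. 0 < \<delta> \<and> compact K \<and> K \<subseteq> ?Q \<and> cylinder_box \<alpha> \<delta> c \<inter> ?Q \<subseteq> K \<and>
       cylinder_box \<alpha> \<delta> c \<inter> ?Q \<subseteq> A \<times> J \<longrightarrow>
       emeasure \<epsilon> (?Q \<inter> cylinder \<alpha> \<delta> c) \<le> C * ennreal (\<delta> powr s)"
      using u p A J \<Omega>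
      by (intro dissipation_cylinder_bound[OF exps(1-4) _ _ _ _ _ _ _ _ _ _ \<epsilon> pairing])
         (auto simp: mixed_space_loc_def intro: borel_compact)
    then obtain C where C: "C < top" "\<And>c \<delta>. 0 < \<delta> \<Longrightarrow> cylinder_box \<alpha> \<delta> c \<inter> ?Q \<subseteq> A \<times> J \<Longrightarrow>
       emeasure \<epsilon> (?Q \<inter> cylinder \<alpha> \<delta> c) \<le> C * ennreal (\<delta> powr s)"
      using K by metis
    let ?U = "ball (fst z) R \<times> {snd z - R <..< snd z + R}"
    have "open ?U" "z \<in> ?U" "0 < min R (R powr (1 / \<alpha>))"
      using R by (cases z; auto intro: open_Times)+
    moreover have "emeasure \<epsilon> (?Q \<inter> cylinder \<alpha> \<delta> c) \<le> C * ennreal (\<delta> powr s)"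
      if "0 < \<delta>" "\<delta> < min R (R powr (1 / \<alpha>))" "cylinder \<alpha> \<delta> c \<inter> ?U \<noteq> {}" for c \<delta>
    proof (rule C(2))
      have "cylinder_box \<alpha> \<delta> c \<subseteq> A \<times> J"
        unfolding A_def J_def using that small_radius[OF exps(5) R] by (intro cylinder_box_near) auto
      then show "cylinder_box \<alpha> \<delta> c \<inter> ?Q \<subseteq> A \<times> J" by blast
    qed (fact that(1))
    ultimately show "\<exists>U \<rho> C. open U \<and> z \<in> U \<and> 0 < \<rho> \<and> C < top \<and>
       (\<forall>c \<delta>. 0 < \<delta> \<and> \<delta> < \<rho> \<and> cylinder \<alpha> \<delta> c \<inter> U \<noteq> {} \<longrightarrow>
          emeasure \<epsilon> (?Q \<inter> cylinder \<alpha> \<delta> c) \<le> C * ennreal (\<delta> powr s))"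
      using C(1) by blast
  qed
qed

text \<open>The closure of \<open>\<Omega>\<close> is compact, so test functions only have to stay away from time \<open>0\<close>, and the
  norms over the whole of \<open>\<Omega> \<times> (0,T)\<close> give one constant for all cylinders.\<close>

lemma boundary_dissipation_abs_cont:
  fixes \<Omega> :: "'a::euclidean_space set"
  assumes \<Omega>: "open \<Omega>"
    and exps: "3 \<le> r" "3 \<le> q" "s = dissip_exponent DIM('a) r q" "\<alpha> = time_exponent DIM('a) r q" "0 < \<alpha>"
    and u: "u \<in> mixed_space q {0<..<T} r \<Omega>"
    and p: "p \<in> mixed_space (q / 2) {0<..<T} (r / 2) \<Omega>"
    and diss: "boundary_extendable_dissipation \<Omega> T u p \<epsilon>"
  shows "abs_cont_aniso_hausdorff \<epsilon> \<alpha> s"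
proof -
  let ?Q = "\<Omega> \<times> {0<..<T}" and ?X = "closure \<Omega> \<times> {0<..T}"
  have \<epsilon>: "local_measure ?X \<epsilon>" and bd: "bounded \<Omega>"
    and pairing: "\<And>\<phi>. \<phi> \<in> test_C 1 ?X \<Longrightarrow> energy_pairing ?Q u p \<phi> = (\<integral>z. \<phi> z \<partial>\<epsilon>)"
    using diss by (simp_all add: boundary_extendable_dissipation_def Let_def)
  have "\<exists>C<top. \<forall>c \<delta> K. 0 < \<delta> \<and> compact K \<and> K \<subseteq> ?X \<and> cylinder_box \<alpha> \<delta> c \<inter> ?X \<subseteq> K \<and>
       cylinder_box \<alpha> \<delta> c \<inter> ?Q \<subseteq> ?Q \<longrightarrow>
       emeasure \<epsilon> (?X \<inter> cylinder \<alpha> \<delta> c) \<le> C * ennreal (\<delta> powr s)"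
    using u p \<Omega>
    by (intro dissipation_cylinder_bound[OF exps(1-4) _ _ _ _ _ _ _ _ _ _ \<epsilon> pairing])
       (auto simp: mixed_space_def)
  then obtain C where C: "C < top" "\<And>c \<delta> K. 0 < \<delta> \<Longrightarrow> compact K \<Longrightarrow> K \<subseteq> ?X \<Longrightarrow>
       cylinder_box \<alpha> \<delta> c \<inter> ?X \<subseteq> K \<Longrightarrow>
       emeasure \<epsilon> (?X \<inter> cylinder \<alpha> \<delta> c) \<le> C * ennreal (\<delta> powr s)"
    by (metis inf_le2)
  have "sets \<epsilon> = sets (restrict_space borel ?X)" using \<epsilon> by (simp add: local_measure_def)
  then show ?thesis
  proof (rule abs_cont_if_locally_density_bound)
    fix z assume "z \<in> ?X"
    \<comment> \<open>Cylinders of half-height at most \<open>R\<close> that reach above time \<open>4R\<close> have their doubled box above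
      time \<open>R\<close>: the loss is \<open>R\<close> down to the centre and \<open>2R\<close> below it.\<close>
    define R where "R = snd z / 8"
    have R: "0 < R" using \<open>z \<in> ?X\<close> by (auto simp: R_def)
    let ?U = "(UNIV :: 'a set) \<times> {4 * R <..}"
    have "open ?U" "z \<in> ?U" "0 < R powr (1 / \<alpha>)"
      using R by (cases z; auto simp: R_def intro: open_Times)+
    moreover have "emeasure \<epsilon> (?X \<inter> cylinder \<alpha> \<delta> c) \<le> C * ennreal (\<delta> powr s)"
      if \<delta>: "0 < \<delta>" "\<delta> < R powr (1 / \<alpha>)" and meet: "cylinder \<alpha> \<delta> c \<inter> ?U \<noteq> {}" for c \<delta>
    proof (rule C(2)[of _ "closure \<Omega> \<times> {R..T}"])
      show "compact (closure \<Omega> \<times> {R..T})"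
        using bd by (intro compact_Times) auto
      show "closure \<Omega> \<times> {R..T} \<subseteq> ?X" using R by auto
      have "R \<le> snd w" if "w \<in> cylinder_box \<alpha> \<delta> c" for w
        using meet that small_radius[OF exps(5) R \<delta>] by (auto simp: cylinder_def cylinder_box_def)
      then show "cylinder_box \<alpha> \<delta> c \<inter> ?X \<subseteq> closure \<Omega> \<times> {R..T}" by auto
    qed (fact \<delta>(1))
    ultimately show "\<exists>U \<rho> C. open U \<and> z \<in> U \<and> 0 < \<rho> \<and> C < top \<and>
       (\<forall>c \<delta>. 0 < \<delta> \<and> \<delta> < \<rho> \<and> cylinder \<alpha> \<delta> c \<inter> U \<noteq> {} \<longrightarrow>
          emeasure \<epsilon> (?X \<inter> cylinder \<alpha> \<delta> c) \<le> C * ennreal (\<delta> powr s))"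
      using C(1) by blast
  qed
qed

theorem theorem1p2:
  fixes \<Omega> :: "(real ^ 'n) set" and T s \<alpha> :: real and r q :: ennreal
    and u :: "(real ^ 'n) \<times> real \<Rightarrow> real ^ 'n" and p :: "(real ^ 'n) \<times> real \<Rightarrow> real"
  assumes "CARD('n) \<ge> 2"
    and "open \<Omega>" "connected \<Omega>" "\<Omega> \<noteq> {}"
    and "0 < T" "3 \<le> r" "3 \<le> q"
    and "s = dissip_exponent CARD('n) r q" "0 \<le> s"
    and "\<alpha> = time_exponent CARD('n) r q" "0 < \<alpha>"
  shows
    "(\<forall>\<epsilon>. u \<in> mixed_space_loc q {0<..<T} r \<Omega> \<and> p \<in> mixed_space_loc (q / 2) {0<..<T} (r / 2) \<Omega> \<and>
          weak_euler_solution \<Omega> T u p \<and> local_dissipation \<Omega> T u p \<epsilon> \<longrightarrow>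
        abs_cont_aniso_hausdorff \<epsilon> \<alpha> s \<and>
        (\<forall>S. emeasure \<epsilon> (space \<epsilon>) \<noteq> 0 \<and> concentrated_on \<epsilon> S \<longrightarrow> ereal s \<le> aniso_dim \<alpha> S)) \<and>
     (\<forall>\<epsilon>. bounded \<Omega> \<and>
          u \<in> mixed_space q {0<..<T} r \<Omega> \<and> p \<in> mixed_space (q / 2) {0<..<T} (r / 2) \<Omega> \<and>
          weak_euler_solution \<Omega> T u p \<and> boundary_extendable_dissipation \<Omega> T u p \<epsilon> \<longrightarrow>
        abs_cont_aniso_hausdorff \<epsilon> \<alpha> s \<and>
        (\<forall>S. emeasure \<epsilon> (space \<epsilon>) \<noteq> 0 \<and> concentrated_on \<epsilon> S \<longrightarrow> ereal s \<le> aniso_dim \<alpha> S))"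
proof -
  have exps: "3 \<le> r" "3 \<le> q" "s = dissip_exponent DIM(real ^ 'n) r q"
    "\<alpha> = time_exponent DIM(real ^ 'n) r q" "0 < \<alpha>"
    using assms by simp_all
  have "abs_cont_aniso_hausdorff \<epsilon> \<alpha> s \<and>
      (\<forall>S. emeasure \<epsilon> (space \<epsilon>) \<noteq> 0 \<and> concentrated_on \<epsilon> S \<longrightarrow> ereal s \<le> aniso_dim \<alpha> S)"
    if "u \<in> mixed_space_loc q {0<..<T} r \<Omega>" "p \<in> mixed_space_loc (q / 2) {0<..<T} (r / 2) \<Omega>"
      "local_dissipation \<Omega> T u p \<epsilon>" for \<epsilon>
  proof -
    have "sets \<epsilon> = sets (restrict_space borel (\<Omega> \<times> {0<..<T}))"
      using that(3) by (simp add: local_dissipation_def local_measure_def Let_def)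
    with local_dissipation_abs_cont[OF assms(2) exps that] show ?thesis
      by (auto intro: aniso_dim_ge_if_abs_cont)
  qed
  moreover have "abs_cont_aniso_hausdorff \<epsilon> \<alpha> s \<and>
      (\<forall>S. emeasure \<epsilon> (space \<epsilon>) \<noteq> 0 \<and> concentrated_on \<epsilon> S \<longrightarrow> ereal s \<le> aniso_dim \<alpha> S)"
    if "u \<in> mixed_space q {0<..<T} r \<Omega>" "p \<in> mixed_space (q / 2) {0<..<T} (r / 2) \<Omega>"
      "boundary_extendable_dissipation \<Omega> T u p \<epsilon>" for \<epsilon>
  proof -
    have "sets \<epsilon> = sets (restrict_space borel (closure \<Omega> \<times> {0<..T}))"
      using that(3) by (simp add: boundary_extendable_dissipation_def local_measure_def Let_def)
    with boundary_dissipation_abs_cont[OF assms(2) exps that] show ?thesis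
      by (auto intro: aniso_dim_ge_if_abs_cont)
  qed
  ultimately show ?thesis by blast
qed

end
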